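(* Let $\mathcal C$ be one of the following classes of games: parity games, mean-payoff games, quantitative reachability games, energy games, discounted-sum games. Then, in the class $\mathcal C$, each of the Nash-checking problem, the deterministic Nash-checking problem, the subgame-perfect-checking problem and the deterministic subgame-perfect-checking problem reduces in polynomial time to the privilege problem in the class $\mathcal C$.
   Context: Games. A game $G=(\Pi,V,(V_i)_{i\in\Pi},E,\mu)$ consists of a finite set $\Pi$ of players, a finite directed graph $(V,E)$ in which every vertex has at least one outgoing edge, a partition $(V_i)_{i\in\Pi}$ of $V$ (parts may be empty; $V_i$ is controlled by $i$), and a payoff function $\mu=(\mu_i)_{i\in\Pi}$ mapping plays (infinite paths) to $\mathbb R^\Pi$. Histories are finite paths. $G_{\upharpoonright v_0}$ denotes the game with initial vertex $v_0$ (plays and histories start at $v_0$). Classes. Parity: each player $i$ has a colouring $\kappa_i:V\to\mathbb N$ and $\mu_i(\pi)=1$ if the minimal $\kappa_i$-colour of a vertex occurring infinitely often in $\pi$ is even, else $0$. Quantitative reachability: each player $i$ has a target $T_i\subseteq V$ and $\mu_i(\pi)=\frac1{1+\inf\{n:\pi_n\in T_i\}}$ (with $\inf\emptyset=+\infty$, $\frac1{+\infty}=0$). In the other three classes each player has a reward mapping $r_i:E\to\mathbb Q$. Energy: $\mathrm{EL}_i(h_0)=0$; $\mathrm{EL}_i(h_0\dots h_{n+1})=\mathrm{EL}_i(h_0\dots h_n)+r_i(h_nh_{n+1})$ if $\mathrm{EL}_i(h_0\dots h_n)\neq\bot$ and this sum is $\ge0$, and $\bot$ otherwise; $\mu_i(\pi)=0$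 if $\mathrm{EL}_i$ is $\bot$ on some prefix of $\pi$, else $1$. Discounted-sum: for a common discount factor $\lambda\in(0,1)\cap\mathbb Q$, $\mu_i(\pi)=\sum_{k\ge0}\lambda^kr_i(\pi_k\pi_{k+1})$. Mean-payoff: $\mu_i(\pi)=\liminf_n\frac1n\sum_{k<n}r_i(\pi_k\pi_{k+1})$. Strategies and equilibria. A strategy $\sigma_i$ of player $i$ maps each history $hv$ from $v_0$ with $v\in V_i$ to a successor of $v$; a profile $\bar\sigma=(\sigma_i)_{i\in\Pi}$ has a unique compatible play, its outcome $\langle\bar\sigma\rangle$; $\bar\sigma(hv)=\sigma_i(hv)$ for $v\in V_i$. $\bar\sigma$ is a Nash equilibrium (NE) if $\mu_i(\langle\sigma'_i,\bar\sigma_{-i}\rangle)\le\mu_i(\langle\bar\sigma\rangle)$ for all $i,\sigma'_i$. It is a subgame-perfect equilibrium (SPE) if for each history $hv$ from $v_0$, the profile $h'\mapsto\bar\sigma(hh')$ is an NE in the game from $v$ with payoff $\pi\mapsto\mu(h\pi)$. Mealy machines. A multiplayer Mealy machine for $\Pi$ on $G$ is $M=(Q,q_0,\Delta)$ with $Q$ finite, $q_0\in Q$, $\Delta\subseteq Q\times V\times Q\times V$, with $uv\in E$ for every $(p,u,q,v)\in\Delta$, and at least one transition $(p,u,q,v)$ for all $p\in Q$, $u\in V$; it is deterministic if there is exactly one for all $p,u$. $\bar\sigma\in\mathrm{Comp}_{\upharpoonright v_0}(M)$ if there is a map $h\mapsto q_h\in Q$ (on histories from $v_0$ and the empty history, with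 the empty history mapped to $q_0$) such that $(q_h,v,q_{hv},\bar\sigma(hv))\in\Delta$ for every history $hv$ from $v_0$. Checking problems. The (deterministic) Nash-checking (resp. subgame-perfect-checking) problem in $\mathcal C$: given $G_{\upharpoonright v_0}\in\mathcal C$ and a (deterministic) multiplayer Mealy machine $M$ for $\Pi$ on $G$, is every $\bar\sigma\in\mathrm{Comp}_{\upharpoonright v_0}(M)$ an NE (resp. SPE)? Privilege problem in $\mathcal C$: given $G_{\upharpoonright v_0}\in\mathcal C$ with two players $\mathbb A$ and $\mathbb E$, does every play $\pi$ in $G_{\upharpoonright v_0}$ satisfy $\mu_{\mathbb A}(\pi)\ge\mu_{\mathbb E}(\pi)$? Numbers are encoded in a usual binary encoding. *)

theory Defs
  imports
    Complex_Main
    "HOL-Library.Disjoint_Sets"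
    "HOL-Library.Extended_Real"
    "HOL-Library.Omega_Words_Fun"
begin

section \<open>Games\<close>

text \<open>
  A game is an arena together with a payoff function of type
  \<^typ>\<open>'p \<Rightarrow> 'v word \<Rightarrow> real\<close>.
\<close>

record ('p, 'v) arena =
  players :: "'p set"
  verts :: "'v set"
  part :: "'p \<Rightarrow> 'v set"
  edges :: "('v \<times> 'v) set"

definition arena :: "('p, 'v) arena \<Rightarrow> bool" where
  "arena A \<longleftrightarrow>
     finite (players A) \<and> finite (verts A) \<and>
     edges A \<subseteq> verts A \<times> verts A \<and>
     (\<forall>u\<in>verts A. \<exists>v. (u, v) \<in> edges A) \<and>
     (\<Union>i\<in>players A. part A i) = verts A \<and>
     disjoint_family_on (part A) (players A)"

definition play :: "('p, 'v) arena \<Rightarrow> 'v \<Rightarrow> 'v word \<Rightarrow> bool" where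
  "play A v0 \<pi> \<longleftrightarrow> \<pi> 0 = v0 \<and> (\<forall>n. (\<pi> n, \<pi> (Suc n)) \<in> edges A)"

definition history :: "('p, 'v) arena \<Rightarrow> 'v \<Rightarrow> 'v list \<Rightarrow> bool" where
  "history A v0 h \<longleftrightarrow> h \<noteq> [] \<and> hd h = v0 \<and> successively (\<lambda>u v. (u, v) \<in> edges A) h"


subsection \<open>Strategies and equilibria\<close>

definition strategy :: "('p, 'v) arena \<Rightarrow> 'v \<Rightarrow> 'p \<Rightarrow> ('v list \<Rightarrow> 'v) \<Rightarrow> bool" where
  "strategy A v0 i s \<longleftrightarrow>
     (\<forall>h v. history A v0 (h @ [v]) \<and> v \<in> part A i \<longrightarrow> (v, s (h @ [v])) \<in> edges A)"

definition profile :: "('p, 'v) arena \<Rightarrow> 'v \<Rightarrow> ('p \<Rightarrow> 'v list \<Rightarrow> 'v) \<Rightarrow> bool" where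
  "profile A v0 \<sigma> \<longleftrightarrow> (\<forall>i\<in>players A. strategy A v0 i (\<sigma> i))"

definition owner :: "('p, 'v) arena \<Rightarrow> 'v \<Rightarrow> 'p" where
  "owner A v = (THE i. i \<in> players A \<and> v \<in> part A i)"

definition profile_move :: "('p, 'v) arena \<Rightarrow> ('p \<Rightarrow> 'v list \<Rightarrow> 'v) \<Rightarrow> 'v list \<Rightarrow> 'v" where
  "profile_move A \<sigma> h = \<sigma> (owner A (last h)) h"

definition compatible_play ::
    "('p, 'v) arena \<Rightarrow> 'v \<Rightarrow> ('p \<Rightarrow> 'v list \<Rightarrow> 'v) \<Rightarrow> 'v word \<Rightarrow> bool" where
  "compatible_play A v0 \<sigma> \<pi> \<longleftrightarrow>
     play A v0 \<pi> \<and> (\<forall>n. \<pi> (Suc n) = profile_move A \<sigma> (prefix (Suc n) \<pi>))"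

definition outcome :: "('p, 'v) arena \<Rightarrow> 'v \<Rightarrow> ('p \<Rightarrow> 'v list \<Rightarrow> 'v) \<Rightarrow> 'v word" where
  "outcome A v0 \<sigma> = (THE \<pi>. compatible_play A v0 \<sigma> \<pi>)"

definition nash_equilibrium ::
    "('p, 'v) arena \<Rightarrow> ('p \<Rightarrow> 'v word \<Rightarrow> real) \<Rightarrow> 'v \<Rightarrow> ('p \<Rightarrow> 'v list \<Rightarrow> 'v) \<Rightarrow> bool" where
  "nash_equilibrium A \<mu> v0 \<sigma> \<longleftrightarrow>
     profile A v0 \<sigma> \<and>
     (\<forall>i\<in>players A. \<forall>s. strategy A v0 i s \<longrightarrow>
        \<mu> i (outcome A v0 (\<sigma>(i := s))) \<le> \<mu> i (outcome A v0 \<sigma>))"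

definition subgame_perfect_equilibrium ::
    "('p, 'v) arena \<Rightarrow> ('p \<Rightarrow> 'v word \<Rightarrow> real) \<Rightarrow> 'v \<Rightarrow> ('p \<Rightarrow> 'v list \<Rightarrow> 'v) \<Rightarrow> bool" where
  "subgame_perfect_equilibrium A \<mu> v0 \<sigma> \<longleftrightarrow>
     profile A v0 \<sigma> \<and>
     (\<forall>h v. history A v0 (h @ [v]) \<longrightarrow>
        nash_equilibrium A (\<lambda>i \<pi>. \<mu> i (h \<frown> \<pi>)) v (\<lambda>i h'. \<sigma> i (h @ h')))"


subsection \<open>The five classes of games\<close>

datatype ('p, 'v) objective =
    Parity "'p \<Rightarrow> 'v \<Rightarrow> nat"
  | Mean_Payoff "'p \<Rightarrow> 'v \<times> 'v \<Rightarrow> rat"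
  | Quantitative_Reachability "'p \<Rightarrow> 'v set"
  | Energy "'p \<Rightarrow> 'v \<times> 'v \<Rightarrow> rat"
  | Discounted_Sum rat "'p \<Rightarrow> 'v \<times> 'v \<Rightarrow> rat"

text \<open>The energy level along the prefix \<open>\<pi> 0, \<dots>, \<pi> n\<close>; \<^const>\<open>None\<close> stands for bottom.\<close>

primrec energy_level :: "('v \<times> 'v \<Rightarrow> rat) \<Rightarrow> 'v word \<Rightarrow> nat \<Rightarrow> rat option" where
  "energy_level r \<pi> 0 = Some 0"
| "energy_level r \<pi> (Suc n) =
     (case energy_level r \<pi> n of
        None \<Rightarrow> None
      | Some e \<Rightarrow>
          if 0 \<le> e + r (\<pi> n, \<pi> (Suc n)) then Some (e + r (\<pi> n, \<pi> (Suc n))) else None)"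

fun payoff :: "('p, 'v) objective \<Rightarrow> 'p \<Rightarrow> 'v word \<Rightarrow> real" where
  "payoff (Parity \<kappa>) i \<pi> = (if even (Min (\<kappa> i ` limit \<pi>)) then 1 else 0)"
| "payoff (Mean_Payoff r) i \<pi> =
     real_of_ereal
       (liminf (\<lambda>n. ereal ((\<Sum>k<n. real_of_rat (r i (\<pi> k, \<pi> (Suc k)))) / real n)))"
| "payoff (Quantitative_Reachability T) i \<pi> =
     (if \<exists>n. \<pi> n \<in> T i then 1 / (1 + real (LEAST n. \<pi> n \<in> T i)) else 0)"
| "payoff (Energy r) i \<pi> = (if \<exists>n. energy_level (r i) \<pi> n = None then 0 else 1)"
| "payoff (Discounted_Sum lam r) i \<pi> =
     (\<Sum>k. real_of_rat lam ^ k * real_of_rat (r i (\<pi> k, \<pi> (Suc k))))"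

datatype game_class =
    Parity_Games
  | Mean_Payoff_Games
  | Quantitative_Reachability_Games
  | Energy_Games
  | Discounted_Sum_Games

fun objective_class :: "('p, 'v) objective \<Rightarrow> game_class" where
  "objective_class (Parity \<kappa>) = Parity_Games"
| "objective_class (Mean_Payoff r) = Mean_Payoff_Games"
| "objective_class (Quantitative_Reachability T) = Quantitative_Reachability_Games"
| "objective_class (Energy r) = Energy_Games"
| "objective_class (Discounted_Sum lam r) = Discounted_Sum_Games"

fun objective_on :: "('p, 'v) arena \<Rightarrow> ('p, 'v) objective \<Rightarrow> bool" where
  "objective_on A (Quantitative_Reachability T) \<longleftrightarrow> (\<forall>i\<in>players A. T i \<subseteq> verts A)"
| "objective_on A (Discounted_Sum lam r) \<longleftrightarrow> 0 < lam \<and> lam < 1"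
| "objective_on A _ \<longleftrightarrow> True"


subsection \<open>Multiplayer Mealy machines\<close>

record ('q, 'v) mealy =
  states :: "'q set"
  start :: 'q
  delta :: "('q \<times> 'v \<times> 'q \<times> 'v) set"

definition mealy_machine :: "('p, 'v) arena \<Rightarrow> ('q, 'v) mealy \<Rightarrow> bool" where
  "mealy_machine A M \<longleftrightarrow>
     finite (states M) \<and> start M \<in> states M \<and>
     delta M \<subseteq> states M \<times> verts A \<times> states M \<times> verts A \<and>
     (\<forall>(p, u, q, v)\<in>delta M. (u, v) \<in> edges A) \<and>
     (\<forall>p\<in>states M. \<forall>u\<in>verts A. \<exists>q v. (p, u, q, v) \<in> delta M)"

definition deterministic :: "('p, 'v) arena \<Rightarrow> ('q, 'v) mealy \<Rightarrow> bool" where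
  "deterministic A M \<longleftrightarrow>
     (\<forall>p\<in>states M. \<forall>u\<in>verts A. \<exists>!qv. (p, u, qv) \<in> delta M)"

definition Comp ::
    "('p, 'v) arena \<Rightarrow> 'v \<Rightarrow> ('q, 'v) mealy \<Rightarrow> ('p \<Rightarrow> 'v list \<Rightarrow> 'v) set" where
  "Comp A v0 M =
     {\<sigma>. profile A v0 \<sigma> \<and>
       (\<exists>\<rho>. \<rho> [] = start M \<and> (\<forall>h. history A v0 h \<longrightarrow> \<rho> h \<in> states M) \<and>
         (\<forall>h v. history A v0 (h @ [v]) \<longrightarrow>
            (\<rho> h, v, \<rho> (h @ [v]), profile_move A \<sigma> (h @ [v])) \<in> delta M))}"


section \<open>Polynomial time\<close>

text \<open>
  The model of computation is the WHILE language on binary trees of N. D. Jones (Computability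
  and Complexity from a Programming Perspective, MIT Press, 1997). Every basic step is charged
  for the sizes of all the trees it reads, so that a run of cost \<open>t\<close> on an input of size \<open>n\<close> only
  handles trees of size at most \<open>n + t\<close>, and programs and Turing machines simulate each other
  with polynomial overhead. The size of a tree is its number of inner nodes.
\<close>

datatype tree = Leaf | Node tree tree

type_synonym store = "nat \<Rightarrow> tree"

datatype expr = Empty | Var nat | Join nat nat | Fst nat | Snd nat

fun eval :: "expr \<Rightarrow> store \<Rightarrow> tree" where
  "eval Empty s = Leaf"
| "eval (Var x) s = s x"
| "eval (Join x y) s = Node (s x) (s y)"
| "eval (Fst x) s = (case s x of Leaf \<Rightarrow> Leaf | Node l r \<Rightarrow> l)"
| "eval (Snd x) s = (case s x of Leaf \<Rightarrow> Leaf | Node l r \<Rightarrow> r)"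

fun cost :: "expr \<Rightarrow> store \<Rightarrow> nat" where
  "cost Empty s = 1"
| "cost (Var x) s = 1 + size (s x)"
| "cost (Join x y) s = 1 + size (s x) + size (s y)"
| "cost (Fst x) s = 1 + size (s x)"
| "cost (Snd x) s = 1 + size (s x)"

datatype com =
    Assign nat expr
  | Seq com com
  | If nat com com
  | While nat com

inductive exec :: "com \<Rightarrow> store \<Rightarrow> nat \<Rightarrow> store \<Rightarrow> bool" where
  Assign: "exec (Assign x e) s (cost e s) (s(x := eval e s))"
| Seq: "exec c1 s t1 s' \<Longrightarrow> exec c2 s' t2 s'' \<Longrightarrow> exec (Seq c1 c2) s (t1 + t2) s''"
| IfTrue: "s x \<noteq> Leaf \<Longrightarrow> exec c1 s t s' \<Longrightarrow> exec (If x c1 c2) s (1 + t) s'"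
| IfFalse: "s x = Leaf \<Longrightarrow> exec c2 s t s' \<Longrightarrow> exec (If x c1 c2) s (1 + t) s'"
| WhileFalse: "s x = Leaf \<Longrightarrow> exec (While x c) s 1 s"
| WhileTrue: "s x \<noteq> Leaf \<Longrightarrow> exec c s t1 s' \<Longrightarrow> exec (While x c) s' t2 s'' \<Longrightarrow>
    exec (While x c) s (1 + t1 + t2) s''"

text \<open>Input and output are held in variable 0; every other variable initially holds \<^const>\<open>Leaf\<close>.\<close>

definition poly_time :: "(tree \<Rightarrow> tree) \<Rightarrow> bool" where
  "poly_time f \<longleftrightarrow>
     (\<exists>c k. \<forall>x. \<exists>t s. exec c ((\<lambda>_. Leaf)(0 := x)) t s \<and> s 0 = f x \<and> t \<le> size x ^ k + k)"

record 'a problem =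
  instance_of :: "'a \<Rightarrow> bool"
  positive :: "'a \<Rightarrow> bool"
  encode :: "'a \<Rightarrow> tree"

definition reduces_poly_time :: "'a problem \<Rightarrow> 'b problem \<Rightarrow> bool"  (infix "\<le>\<^sub>p" 50) where
  "P \<le>\<^sub>p R \<longleftrightarrow>
     (\<exists>f. poly_time f \<and>
       (\<forall>x. instance_of P x \<longrightarrow>
          (\<exists>y. instance_of R y \<and> f (encode P x) = encode R y \<and>
               (positive P x \<longleftrightarrow> positive R y))))"


section \<open>Encodings\<close>

fun enc_list :: "('a \<Rightarrow> tree) \<Rightarrow> 'a list \<Rightarrow> tree" where
  "enc_list e [] = Leaf"
| "enc_list e (x # xs) = Node (e x) (enc_list e xs)"

definition enc_bool :: "bool \<Rightarrow> tree" where
  "enc_bool b = (if b then Node Leaf Leaf else Leaf)"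

text \<open>Binary digits, least significant first, without leading zeros.\<close>

fun bits :: "nat \<Rightarrow> bool list" where
  "bits n = (if n = 0 then [] else odd n # bits (n div 2))"

declare bits.simps [simp del]

definition enc_nat :: "nat \<Rightarrow> tree" where
  "enc_nat n = enc_list enc_bool (bits n)"

definition enc_int :: "int \<Rightarrow> tree" where
  "enc_int z = Node (enc_bool (z < 0)) (enc_nat (nat \<bar>z\<bar>))"

definition enc_rat :: "rat \<Rightarrow> tree" where
  "enc_rat q = (case quotient_of q of (a, b) \<Rightarrow> Node (enc_int a) (enc_nat (nat b)))"

definition enc_table :: "nat \<Rightarrow> (nat \<Rightarrow> tree) \<Rightarrow> tree" where
  "enc_table n f = enc_list f [0..<n]"

text \<open>
  In an input, players, vertices and states are initial segments of the natural numbers, and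
  sets and functions are given by their tables. The entry of a reward table at a pair that is
  not an edge is 0.
\<close>

record game_input =
  arena_of :: "(nat, nat) arena"
  objective_of :: "(nat, nat) objective"
  initial :: nat

definition enc_arena :: "(nat, nat) arena \<Rightarrow> tree" where
  "enc_arena A =
     (let k = card (players A); n = card (verts A) in
      Node (enc_table k (\<lambda>i. enc_table n (\<lambda>v. enc_bool (v \<in> part A i))))
           (enc_table n (\<lambda>u. enc_table n (\<lambda>v. enc_bool ((u, v) \<in> edges A)))))"

definition enc_rewards :: "(nat, nat) arena \<Rightarrow> (nat \<Rightarrow> nat \<times> nat \<Rightarrow> rat) \<Rightarrow> tree" where
  "enc_rewards A r =
     (let k = card (players A); n = card (verts A) in
      enc_table k (\<lambda>i. enc_table n (\<lambda>u. enc_table n (\<lambda>v.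
        enc_rat (if (u, v) \<in> edges A then r i (u, v) else 0)))))"

fun enc_objective :: "(nat, nat) arena \<Rightarrow> (nat, nat) objective \<Rightarrow> tree" where
  "enc_objective A (Parity \<kappa>) =
     enc_table (card (players A)) (\<lambda>i. enc_table (card (verts A)) (\<lambda>v. enc_nat (\<kappa> i v)))"
| "enc_objective A (Mean_Payoff r) = enc_rewards A r"
| "enc_objective A (Quantitative_Reachability T) =
     enc_table (card (players A)) (\<lambda>i. enc_table (card (verts A)) (\<lambda>v. enc_bool (v \<in> T i)))"
| "enc_objective A (Energy r) = enc_rewards A r"
| "enc_objective A (Discounted_Sum lam r) = Node (enc_rat lam) (enc_rewards A r)"

definition enc_game :: "game_input \<Rightarrow> tree" where
  "enc_game G =
     Node (enc_arena (arena_of G))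
       (Node (enc_objective (arena_of G) (objective_of G)) (enc_nat (initial G)))"

definition enc_mealy :: "(nat, nat) arena \<Rightarrow> (nat, nat) mealy \<Rightarrow> tree" where
  "enc_mealy A M =
     (let m = card (states M); n = card (verts A) in
      Node (enc_nat (start M))
        (enc_table m (\<lambda>p. enc_table n (\<lambda>u. enc_table m (\<lambda>q. enc_table n (\<lambda>v.
          enc_bool ((p, u, q, v) \<in> delta M)))))))"


section \<open>The decision problems\<close>

definition game_in_class :: "game_class \<Rightarrow> game_input \<Rightarrow> bool" where
  "game_in_class C G \<longleftrightarrow>
     (\<exists>k. players (arena_of G) = {..<k}) \<and> (\<exists>n. verts (arena_of G) = {..<n}) \<and>
     arena (arena_of G) \<and> initial G \<in> verts (arena_of G) \<and>
     objective_on (arena_of G) (objective_of G) \<and> objective_class (objective_of G) = C"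

definition mealy_input :: "game_input \<Rightarrow> (nat, nat) mealy \<Rightarrow> bool" where
  "mealy_input G M \<longleftrightarrow> (\<exists>m. states M = {..<m}) \<and> mealy_machine (arena_of G) M"

type_synonym checking_input = "game_input \<times> (nat, nat) mealy"

definition enc_checking :: "checking_input \<Rightarrow> tree" where
  "enc_checking = (\<lambda>(G, M). Node (enc_game G) (enc_mealy (arena_of G) M))"

definition nash_checking :: "game_class \<Rightarrow> checking_input problem" where
  "nash_checking C =
     \<lparr> instance_of = (\<lambda>(G, M). game_in_class C G \<and> mealy_input G M),
       positive = (\<lambda>(G, M). \<forall>\<sigma>\<in>Comp (arena_of G) (initial G) M.
         nash_equilibrium (arena_of G) (payoff (objective_of G)) (initial G) \<sigma>),
       encode = enc_checking \<rparr>"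

definition subgame_perfect_checking :: "game_class \<Rightarrow> checking_input problem" where
  "subgame_perfect_checking C =
     \<lparr> instance_of = (\<lambda>(G, M). game_in_class C G \<and> mealy_input G M),
       positive = (\<lambda>(G, M). \<forall>\<sigma>\<in>Comp (arena_of G) (initial G) M.
         subgame_perfect_equilibrium (arena_of G) (payoff (objective_of G)) (initial G) \<sigma>),
       encode = enc_checking \<rparr>"

definition restrict_deterministic :: "checking_input problem \<Rightarrow> checking_input problem" where
  "restrict_deterministic P =
     P\<lparr> instance_of := (\<lambda>(G, M). instance_of P (G, M) \<and> deterministic (arena_of G) M) \<rparr>"

definition deterministic_nash_checking :: "game_class \<Rightarrow> checking_input problem" where
  "deterministic_nash_checking C = restrict_deterministic (nash_checking C)"

definition deterministic_subgame_perfect_checking :: "game_class \<Rightarrow> checking_input problem" where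
  "deterministic_subgame_perfect_checking C = restrict_deterministic (subgame_perfect_checking C)"

abbreviation (input) player_A :: nat where "player_A \<equiv> 0"
abbreviation (input) player_E :: nat where "player_E \<equiv> 1"

definition privilege :: "game_class \<Rightarrow> game_input problem" where
  "privilege C =
     \<lparr> instance_of = (\<lambda>G. game_in_class C G \<and> players (arena_of G) = {player_A, player_E}),
       positive = (\<lambda>G. \<forall>\<pi>. play (arena_of G) (initial G) \<pi> \<longrightarrow>
         payoff (objective_of G) player_A \<pi> \<ge> payoff (objective_of G) player_E \<pi>),
       encode = enc_game \<rparr>"

end

theory Submission
  imports Defs "HOL-Analysis.Extended_Real_Limits"
begin

text \<open>
  A machine \<open>M\<close> has a compatible profile that is not an equilibrium iff some player \<open>i\<close> has a deviation
  \<open>\<beta>\<close> from a compatible outcome \<open>\<alpha>\<close> with a larger payoff. Once \<open>\<alpha>\<close> and \<open>\<beta>\<close> have diverged, the histories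
  on which the profile is consulted along the two plays are different, so that \<open>M\<close> may be run along
  each of them independently. Hence a two-player game that first chooses \<open>i\<close> and then follows \<open>\<alpha>\<close> and \<open>\<beta>\<close>
  simultaneously, with player A reading off \<open>\<mu>\<^sub>i \<alpha>\<close> and player E reading off \<open>\<mu>\<^sub>i \<beta>\<close>, is privileged iff every
  compatible profile is an equilibrium. In the subgame-perfect case it is enough to consider
  deviations in the first step of a subgame, so the common prefix of \<open>\<alpha>\<close> and \<open>\<beta>\<close> may be any history.
\<close>

section \<open>Polynomial-time functions on trees\<close>

text \<open>On the game side, both payoffs must be expressed by one objective of the same class, on
  an arena with an extra opening move for the choice of \<open>i\<close>. That move delays every
  payoff by one step; the effect is strictly increasing in each class, so the comparison survives.
  All cells become vertices, reachable or not: the arena is then a table filled in by pointwise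
  tests, without any search, and the price is that every cell needs a successor. The machine states
  of the two plays stay equal one step longer than their vertices, because the state after reading
  the last common vertex depends on the common history only. Hence \<open>deviation\<close> asks for
  equal states up to \<open>Suc d\<close>, but equal vertices up to \<open>d\<close>. On the machine
  side, \<open>poly_time\<close> bounds the running time on every tree, malformed ones included, and
  iterating a polynomial-time function may grow exponentially. So all loops go through one lemma on
  bounded iteration, and everything later is composed of total tree functions. Only positions in
  tables are computed with, in unary; rewards and colours are merely copied.\<close>

definition poly_bound :: "(nat \<Rightarrow> nat) \<Rightarrow> bool" where
  "poly_bound p \<longleftrightarrow> (\<exists>k. \<forall>n. p n \<le> (n + 2) ^ k)"

lemma poly_bound_const: "poly_bound (\<lambda>_. c)"
proof -
  have "c \<le> (n + 2) ^ c" for n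
    using less_exp[of c] power_mono[of 2 "n + 2" c] by simp
  then show ?thesis unfolding poly_bound_def by blast
qed

lemma poly_bound_id: "poly_bound (\<lambda>n. n)"
  unfolding poly_bound_def by (rule exI[of _ 1]) simp

lemma poly_bound_mult:
  assumes "poly_bound p" "poly_bound q"
  shows "poly_bound (\<lambda>n. p n * q n)"
proof -
  obtain a b where "\<forall>n. p n \<le> (n + 2) ^ a" "\<forall>n. q n \<le> (n + 2) ^ b"
    using assms unfolding poly_bound_def by blast
  then have "p n * q n \<le> (n + 2) ^ (a + b)" for n
    unfolding power_add by (intro mult_mono) auto
  then show ?thesis unfolding poly_bound_def by blast
qed

text \<open>A sum costs a factor 2, which the base \<open>n + 2\<close> absorbs as one more
  exponent. This is the reason for the base: closure under sums, products and composition becomes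
  arithmetic of exponents.\<close>

lemma poly_bound_add:
  assumes "poly_bound p" "poly_bound q"
  shows "poly_bound (\<lambda>n. p n + q n)"
proof -
  have 1: "p n + q n \<le> 2 * (p n + 1) * (q n + 1)" for n by (simp add: algebra_simps)
  obtain a b where ab: "\<forall>n. p n \<le> (n + 2) ^ a" "\<forall>n. q n \<le> (n + 2) ^ b"
    using assms unfolding poly_bound_def by blast
  have "p n + q n \<le> (n + 2) ^ (a + b + 1)" for n
  proof -
    have "p n \<le> (n + 2) ^ (a + b)" "q n \<le> (n + 2) ^ (a + b)"
      using ab[THEN spec, of n] power_increasing[of a "a + b" "n + 2"]
        power_increasing[of b "a + b" "n + 2"] by linarith+
    then have "p n + q n \<le> 2 * (n + 2) ^ (a + b)" by linarith
    also have "\<dots> \<le> (n + 2) * (n + 2) ^ (a + b)" by (rule mult_right_mono) auto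
    finally show ?thesis by simp
  qed
  then show ?thesis unfolding poly_bound_def by blast
qed

text \<open>Monotonicity is contributed by the bounding power \<open>(n + 2) ^ a\<close>, not by
  \<open>p\<close>.\<close>

lemma poly_bound_compose:
  assumes "poly_bound p" "poly_bound q"
  shows "poly_bound (\<lambda>n. p (q n))"
proof -
  obtain a where a: "\<forall>n. p n \<le> (n + 2) ^ a" using assms unfolding poly_bound_def by blast
  have "poly_bound (\<lambda>n. q n + 2)" by (intro poly_bound_add assms poly_bound_const)
  then obtain b where "\<forall>n. q n + 2 \<le> (n + 2) ^ b" unfolding poly_bound_def by blast
  then have "p (q n) \<le> ((n + 2) ^ b) ^ a" for n
    using a[THEN spec, of "q n"] power_mono[of "q n + 2" "(n + 2) ^ b" a] by (meson le_trans zero_le)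
  then show ?thesis unfolding poly_bound_def power_mult[symmetric] by blast
qed

lemma poly_bound_power: "poly_bound p \<Longrightarrow> poly_bound (\<lambda>n. p n ^ k)"
  by (induction k) (auto intro: poly_bound_const poly_bound_mult)

lemmas poly_bound_intros =
  poly_bound_const poly_bound_id poly_bound_mult poly_bound_add poly_bound_power

lemma poly_bound_monoE:
  assumes "poly_bound p"
  obtains q where "poly_bound q" "mono q" "\<forall>n. p n \<le> q n"
proof -
  obtain k where "\<forall>n. p n \<le> (n + 2) ^ k" using assms unfolding poly_bound_def by blast
  moreover have "mono (\<lambda>n::nat. (n + 2) ^ k)" by (auto intro!: monoI power_mono)
  moreover have "poly_bound (\<lambda>n. (n + 2) ^ k)" by (intro poly_bound_intros)
  ultimately show ?thesis using that by blast
qed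

lemma poly_bound_standard:
  assumes "poly_bound p"
  obtains k where "\<And>n. p n \<le> n ^ k + k"
proof -
  obtain k where k: "\<forall>n. p n \<le> (n + 2) ^ k" using assms unfolding poly_bound_def by blast
  \<comment> \<open>\<open>2 * k\<close> comes from \<open>n + 2 \<le> n * n\<close> for
    \<open>n \<ge> 2\<close>; \<open>3 ^ k\<close> covers the arguments 0 and 1.\<close>
  define K where "K = 2 * k + 3 ^ k"
  have "p n \<le> n ^ K + K" for n
  proof (cases "n \<ge> 2")
    case True
    then have "n + 2 \<le> n * n" using mult_mono[of 2 n n n] by linarith
    then have "(n + 2) ^ k \<le> (n * n) ^ k" by (intro power_mono) auto
    also have "\<dots> = n ^ (2 * k)" by (simp add: power_mult power2_eq_square)
    also have "\<dots> \<le> n ^ K" using True by (intro power_increasing) (auto simp: K_def)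
    finally show ?thesis using k[THEN spec, of n] by linarith
  next
    case False
    then have "(n + 2) ^ k \<le> 3 ^ k" by (intro power_mono) auto
    then show ?thesis using k[THEN spec, of n] by (simp add: K_def)
  qed
  then show ?thesis by (rule that)
qed


section \<open>Relocation of programs and the calling convention\<close>

primrec shift_expr :: "nat \<Rightarrow> expr \<Rightarrow> expr" where
  "shift_expr k Empty = Empty"
| "shift_expr k (Var x) = Var (k + x)"
| "shift_expr k (Join x y) = Join (k + x) (k + y)"
| "shift_expr k (Fst x) = Fst (k + x)"
| "shift_expr k (Snd x) = Snd (k + x)"

primrec shift_com :: "nat \<Rightarrow> com \<Rightarrow> com" where
  "shift_com k (Assign x e) = Assign (k + x) (shift_expr k e)"
| "shift_com k (Seq c d) = Seq (shift_com k c) (shift_com k d)"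
| "shift_com k (If x c d) = If (k + x) (shift_com k c) (shift_com k d)"
| "shift_com k (While x c) = While (k + x) (shift_com k c)"

text \<open>\<open>S\<close> is the caller's part of the store, below register \<open>k\<close>;
  \<open>s\<close> is the store as the relocated program sees it.\<close>

definition overlay :: "nat \<Rightarrow> store \<Rightarrow> store \<Rightarrow> store" where
  "overlay k S s = (\<lambda>x. if x < k then S x else s (x - k))"

lemma overlay_add [simp]: "overlay k S s (k + x) = s x"
  by (simp add: overlay_def)

lemma eval_shift: "eval (shift_expr k e) (overlay k S s) = eval e s"
  by (cases e) auto

lemma cost_shift: "cost (shift_expr k e) (overlay k S s) = cost e s"
  by (cases e) auto

lemma overlay_update: "(overlay k S s)(k + x := v) = overlay k S (s(x := v))"
  by (auto simp: overlay_def fun_eq_iff)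

lemma exec_shift:
  "exec c s t s' \<Longrightarrow> exec (shift_com k c) (overlay k S s) t (overlay k S s')"
proof (induction rule: exec.induct)
  case (Assign x e s)
  show ?case
    using exec.Assign[of "k + x" "shift_expr k e" "overlay k S s"]
    unfolding eval_shift cost_shift overlay_update by (simp add: fun_upd_def)
next
  case (Seq c1 s t1 s' c2 t2 s'')
  show ?case unfolding shift_com.simps by (rule exec.Seq[OF Seq.IH])
next
  case (IfTrue s x c1 t s' c2)
  show ?case unfolding shift_com.simps by (rule exec.IfTrue) (use IfTrue in simp_all)
next
  case (IfFalse s x c2 t s' c1)
  show ?case unfolding shift_com.simps by (rule exec.IfFalse) (use IfFalse in simp_all)
next
  case (WhileFalse s x c)
  show ?case unfolding shift_com.simps by (rule exec.WhileFalse) (use WhileFalse in simp)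
next
  case (WhileTrue s x c t1 s' t2 s'')
  then show ?case unfolding shift_com.simps by (intro exec.WhileTrue[of _ _ _ t1 _ t2]) simp_all
qed

primrec assigned :: "com \<Rightarrow> nat set" where
  "assigned (Assign x e) = {x}"
| "assigned (Seq c d) = assigned c \<union> assigned d"
| "assigned (If x c d) = assigned c \<union> assigned d"
| "assigned (While x c) = assigned c"

lemma finite_assigned: "finite (assigned c)"
  by (induction c) auto

lemma exec_unassigned: "exec c s t s' \<Longrightarrow> x \<notin> assigned c \<Longrightarrow> s' x = s x"
  by (induction rule: exec.induct) auto

text \<open>The cost of an assignment pays for the growth it causes: an expression is charged for
  the trees it reads, and \<open>Join\<close> adds a single node.\<close>

lemma exec_size:
  "exec c s t s' \<Longrightarrow> (\<And>x. size (s x) \<le> N) \<Longrightarrow> size (s' x) \<le> N + t"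
proof (induction arbitrary: N x rule: exec.induct)
  case (Assign y e s)
  have "size (eval e s) \<le> N + cost e s"
    using Assign by (cases e) (auto split: tree.split simp: trans_le_add1 trans_le_add2)
  then show ?case using Assign[of x] by simp
next
  case (Seq c1 s t1 s' c2 t2 s'')
  have "size (s'' x) \<le> (N + t1) + t2"
    by (rule Seq.IH(2)) (rule Seq.IH(1)[OF Seq.prems])
  then show ?case by simp
next
  case (WhileTrue s x c t1 s' t2 s'')
  have "size (s'' y) \<le> (N + t1) + t2" for y
    by (rule WhileTrue.IH(2)) (rule WhileTrue.IH(1)[OF WhileTrue.prems])
  from this[of x] show ?case by simp
qed (auto simp: le_SucI)

text \<open>Scratch registers must be \<open>Leaf\<close> again after a call. The base case already
  clears one register, so the range is \<open>k + 1\<close> to \<open>k + m + 1\<close>.\<close>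

primrec clear_vars :: "nat \<Rightarrow> nat \<Rightarrow> com" where
  "clear_vars k 0 = Assign (Suc k) Empty"
| "clear_vars k (Suc m) = Seq (clear_vars k m) (Assign (Suc (Suc (k + m))) Empty)"

lemma exec_clear_vars:
  "exec (clear_vars k m) s (m + 1) (\<lambda>x. if k < x \<and> x \<le> k + m + 1 then Leaf else s x)"
proof (induction m)
  case 0
  have "exec (Assign (Suc k) Empty) s 1 (s(Suc k := Leaf))" using exec.Assign[of _ Empty] by simp
  moreover have "s(Suc k := Leaf) = (\<lambda>x. if k < x \<and> x \<le> k + 0 + 1 then Leaf else s x)" by auto
  ultimately show ?case by simp
next
  case (Suc m)
  let ?s = "\<lambda>x. if k < x \<and> x \<le> k + m + 1 then Leaf else s x"
  have "exec (Assign (Suc (Suc (k + m))) Empty) ?s 1 (?s(Suc (Suc (k + m)) := Leaf))"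
    using exec.Assign[of _ Empty] by simp
  moreover have "?s(Suc (Suc (k + m)) := Leaf) =
      (\<lambda>x. if k < x \<and> x \<le> k + Suc m + 1 then Leaf else s x)"
    by (auto simp: fun_eq_iff)
  ultimately have "exec (clear_vars k (Suc m)) s (m + 1 + 1)
      (\<lambda>x. if k < x \<and> x \<le> k + Suc m + 1 then Leaf else s x)"
    using exec.Seq[OF Suc, of _ 1] by simp
  then show ?case by simp
qed

text \<open>The calling convention: register \<open>k\<close> holds argument and result, the
  registers below it belong to the caller and survive, those above it are \<open>Leaf\<close> before
  and after. Programs obeying it can be chained.\<close>

definition computes_at :: "nat \<Rightarrow> com \<Rightarrow> (nat \<Rightarrow> nat) \<Rightarrow> (tree \<Rightarrow> tree) \<Rightarrow> bool" where
  "computes_at k c p f \<longleftrightarrow> (\<forall>S. (\<forall>j>k. S j = Leaf) \<longrightarrow>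
     (\<exists>t\<le>p (size (S k)). exec c S t (S(k := f (S k)))))"

text \<open>A program assigns finitely many registers, so a constant number of clearing steps makes
  it a subroutine at any \<open>k\<close>. The time bound is delivered monotone because callers only
  know bounds on the size of the argument.\<close>

lemma poly_timeE:
  assumes "poly_time f"
  obtains c p where "poly_bound p" "mono p" "computes_at k c p f"
proof -
  obtain c0 d where c0: "\<exists>t s. exec c0 ((\<lambda>_. Leaf)(0 := x)) t s \<and> s 0 = f x \<and> t \<le> size x ^ d + d" for x
    using assms unfolding poly_time_def by metis
  obtain m where m: "\<forall>x\<in>assigned c0. x \<le> m"
    using finite_assigned[of c0] finite_nat_set_iff_bounded_le by blast
  define c where "c = Seq (shift_com k c0) (clear_vars k m)"
  define p where "p n = n ^ d + d + (m + 1)" for n :: nat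
  have "poly_bound p" unfolding p_def by (intro poly_bound_intros)
  moreover have "mono p" unfolding p_def by (auto intro!: monoI power_mono)
  moreover have "computes_at k c p f"
    unfolding computes_at_def
  proof (intro allI impI)
    fix S :: store assume S: "\<forall>j>k. S j = Leaf"
    let ?x = "S k" and ?s0 = "(\<lambda>_. Leaf)(0 := S k)"
    obtain t s where ts: "exec c0 ?s0 t s" "s 0 = f ?x" "t \<le> size ?x ^ d + d"
      using c0 by blast
    have S0: "overlay k S ?s0 = S" using S by (auto simp: overlay_def fun_eq_iff)
    have s: "s j = Leaf" if "j > m" for j
      using exec_unassigned[OF ts(1), of j] m that by fastforce
    have "(\<lambda>x. if k < x \<and> x \<le> k + m + 1 then Leaf else overlay k S s x) = S(k := f ?x)"
      using S s ts(2) by (auto simp: overlay_def fun_eq_iff)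
    then have "exec c S (t + (m + 1)) (S(k := f ?x))"
      unfolding c_def using exec.Seq[OF exec_shift[OF ts(1), of k S, unfolded S0] exec_clear_vars[of k m]]
      by simp
    then show "\<exists>t\<le>p (size ?x). exec c S t (S(k := f ?x))"
      using ts(3) unfolding p_def by (intro exI[of _ "t + (m + 1)"]) auto
  qed
  ultimately show ?thesis by (rule that)
qed

section \<open>Closure properties of polynomial time\<close>

lemma poly_timeI:
  assumes "poly_bound p" "\<And>x. \<exists>t s. exec c ((\<lambda>_. Leaf)(0 := x)) t s \<and> s 0 = f x \<and> t \<le> p (size x)"
  shows "poly_time f"
  using poly_bound_standard[OF assms(1)] assms(2) unfolding poly_time_def by (meson le_trans)

lemma poly_time_size:
  assumes "poly_time f"
  obtains p where "poly_bound p" "mono p" "\<forall>x. size (f x) \<le> p (size x)"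
proof -
  obtain c p where cp: "poly_bound p" "mono p" "computes_at 0 c p f"
    using poly_timeE[OF assms] .
  have "size (f x) \<le> size x + p (size x)" for x
  proof -
    let ?S = "(\<lambda>_. Leaf)(0 := x)"
    obtain t where t: "t \<le> p (size x)" "exec c ?S t (?S(0 := f x))"
      using cp(3)[unfolded computes_at_def, rule_format, of ?S] by auto
    have "size ((?S(0 := f x)) 0) \<le> size x + t" using exec_size[OF t(2), of "size x" 0] by simp
    then show ?thesis using t(1) by simp
  qed
  moreover have "poly_bound (\<lambda>n. n + p n)" by (intro poly_bound_intros cp)
  moreover have "mono (\<lambda>n. n + p n)" using cp(2) by (auto intro!: monoI add_mono dest: monoD)
  ultimately show ?thesis using that by blast
qed

lemma computes_atD:
  assumes "computes_at k c p f" "\<And>j. j > k \<Longrightarrow> S j = Leaf"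
  obtains t where "exec c S t (S(k := f (S k)))" "t \<le> p (size (S k))"
  using assms unfolding computes_at_def by blast

lemma exec_Assign': "s' = s(x := eval e s) \<Longrightarrow> t = cost e s \<Longrightarrow> exec (Assign x e) s t s'"
  using exec.Assign by simp

lemma runsI:
  "exec c s t s' \<Longrightarrow> s' 0 = v \<Longrightarrow> t \<le> b \<Longrightarrow> \<exists>t s'. exec c s t s' \<and> s' 0 = v \<and> t \<le> b"
  by blast

lemma poly_time_id: "poly_time (\<lambda>x. x)"
proof (rule poly_timeI)
  show "poly_bound (\<lambda>n. 1 + n)" by (intro poly_bound_intros)
  show "\<exists>t s. exec (Assign 0 (Var 0)) ((\<lambda>_. Leaf)(0 := x)) t s \<and> s 0 = x \<and> t \<le> 1 + size x" for x
    by (rule runsI, rule exec_Assign'[OF refl refl]) auto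
qed

lemma poly_time_Leaf: "poly_time (\<lambda>_. Leaf)"
proof (rule poly_timeI)
  show "poly_bound (\<lambda>n. 1)" by (intro poly_bound_intros)
  show "\<exists>t s. exec (Assign 0 Empty) ((\<lambda>_. Leaf)(0 := x)) t s \<and> s 0 = Leaf \<and> t \<le> 1" for x
    by (rule runsI, rule exec_Assign'[OF refl refl]) auto
qed

definition left :: "tree \<Rightarrow> tree" where
  "left t = (case t of Leaf \<Rightarrow> Leaf | Node l r \<Rightarrow> l)"

definition right :: "tree \<Rightarrow> tree" where
  "right t = (case t of Leaf \<Rightarrow> Leaf | Node l r \<Rightarrow> r)"

lemma left_simps [simp]: "left Leaf = Leaf" "left (Node l r) = l"
  and right_simps [simp]: "right Leaf = Leaf" "right (Node l r) = r"
  by (auto simp: left_def right_def)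

lemma size_left: "size (left t) \<le> size t" and size_right: "size (right t) \<le> size t"
  by (cases t; simp)+

lemma poly_time_compose:
  assumes "poly_time f" "poly_time g"
  shows "poly_time (\<lambda>x. f (g x))"
proof -
  obtain c p where c: "poly_bound p" "mono p" "computes_at 0 c p f" using poly_timeE[OF assms(1)] .
  obtain d q where d: "poly_bound q" "mono q" "computes_at 0 d q g" using poly_timeE[OF assms(2)] .
  obtain r where r: "poly_bound r" "mono r" "\<forall>x. size (g x) \<le> r (size x)"
    using poly_time_size[OF assms(2)] .
  show ?thesis
  proof (rule poly_timeI)
    show "poly_bound (\<lambda>n. q n + p (r n))" by (intro poly_bound_intros poly_bound_compose[OF c(1) r(1)] c d r)
    fix x
    let ?S = "(\<lambda>_. Leaf)(0 := x) :: store"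
    obtain t1 where t1: "exec d ?S t1 (?S(0 := g x))" "t1 \<le> q (size x)"
      using computes_atD[OF d(3), of ?S] by auto
    obtain t2 where t2: "exec c (?S(0 := g x)) t2 (?S(0 := g x, 0 := f (g x)))" "t2 \<le> p (size (g x))"
      using computes_atD[OF c(3), of "?S(0 := g x)"] by auto
    have "p (size (g x)) \<le> p (r (size x))" using c(2) r(3) by (simp add: monoD)
    then show "\<exists>t s. exec (Seq d c) ?S t s \<and> s 0 = f (g x) \<and> t \<le> q (size x) + p (r (size x))"
      using t1(2) t2(2) by (intro runsI[OF exec.Seq[OF t1(1) t2(1)]]) auto
  qed
qed

lemma poly_time_left:
  assumes "poly_time f"
  shows "poly_time (\<lambda>x. left (f x))"
proof (rule poly_time_compose[OF _ assms], rule poly_timeI)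
  show "poly_bound (\<lambda>n. 1 + n)" by (intro poly_bound_intros)
  show "\<exists>t s. exec (Assign 0 (Fst 0)) ((\<lambda>_. Leaf)(0 := x)) t s \<and> s 0 = left x \<and> t \<le> 1 + size x" for x
    by (rule runsI, rule exec_Assign'[OF refl refl]) (auto simp: left_def)
qed

lemma poly_time_right:
  assumes "poly_time f"
  shows "poly_time (\<lambda>x. right (f x))"
proof (rule poly_time_compose[OF _ assms], rule poly_timeI)
  show "poly_bound (\<lambda>n. 1 + n)" by (intro poly_bound_intros)
  show "\<exists>t s. exec (Assign 0 (Snd 0)) ((\<lambda>_. Leaf)(0 := x)) t s \<and> s 0 = right x \<and> t \<le> 1 + size x" for x
    by (rule runsI, rule exec_Assign'[OF refl refl]) (auto simp: right_def)
qed

lemma poly_time_Node: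
  assumes "poly_time f" "poly_time g"
  shows "poly_time (\<lambda>x. Node (f x) (g x))"
proof -
  \<comment> \<open>Placing the calls at registers 1 and 2 protects the input in register 0 and,
    during the second call, the value of \<open>f\<close> in register 1.\<close>
  obtain c p where c: "poly_bound p" "mono p" "computes_at 1 c p f" using poly_timeE[OF assms(1)] .
  obtain d q where d: "poly_bound q" "mono q" "computes_at 2 d q g" using poly_timeE[OF assms(2)] .
  obtain p' where p': "poly_bound p'" "mono p'" "\<forall>x. size (f x) \<le> p' (size x)"
    using poly_time_size[OF assms(1)] .
  obtain q' where q': "poly_bound q'" "mono q'" "\<forall>x. size (g x) \<le> q' (size x)"
    using poly_time_size[OF assms(2)] .
  show ?thesis
  proof (rule poly_timeI)
    show "poly_bound (\<lambda>n. (1 + n) + (p n + ((1 + n) + (q n + (1 + p' n + q' n)))))"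
      by (intro poly_bound_intros c d p' q')
    fix x
    let ?S = "(\<lambda>_. Leaf)(0 := x) :: store"
    let ?S1 = "?S(1 := x)"  let ?S2 = "?S(1 := f x)"
    let ?S3 = "?S2(2 := x)" let ?S4 = "?S2(2 := g x)"
    have e1: "exec (Assign 1 (Var 0)) ?S (1 + size x) ?S1" by (rule exec_Assign') auto
    obtain t1 where t1: "exec c ?S1 t1 ?S2" "t1 \<le> p (size x)"
      using computes_atD[OF c(3), of ?S1] by auto
    have e2: "exec (Assign 2 (Var 0)) ?S2 (1 + size x) ?S3" by (rule exec_Assign') auto
    obtain t2 where t2: "exec d ?S3 t2 ?S4" "t2 \<le> q (size x)"
      using computes_atD[OF d(3), of ?S3] by (auto simp: numeral_2_eq_2)
    have e3: "exec (Assign 0 (Join 1 2)) ?S4 (1 + size (f x) + size (g x)) (?S4(0 := Node (f x) (g x)))"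
      by (rule exec_Assign') auto
    show "\<exists>t s. exec (Seq (Assign 1 (Var 0)) (Seq c (Seq (Assign 2 (Var 0)) (Seq d (Assign 0 (Join 1 2))))))
        ?S t s \<and> s 0 = Node (f x) (g x) \<and>
        t \<le> (1 + size x) + (p (size x) + ((1 + size x) + (q (size x) + (1 + p' (size x) + q' (size x)))))"
      by (rule runsI, rule exec.Seq[OF e1 exec.Seq[OF t1(1) exec.Seq[OF e2 exec.Seq[OF t2(1) e3]]]])
        (use t1(2) t2(2) p'(3)[THEN spec, of x] q'(3)[THEN spec, of x] in auto)
  qed
qed

lemma poly_time_const: "poly_time (\<lambda>_. a)"
  by (induction a) (auto intro: poly_time_Leaf poly_time_Node)

definition tif :: "tree \<Rightarrow> tree \<Rightarrow> tree \<Rightarrow> tree" where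
  "tif c a b = (if c = Leaf then b else a)"

lemma poly_time_tif:
  assumes "poly_time h" "poly_time f" "poly_time g"
  shows "poly_time (\<lambda>x. tif (h x) (f x) (g x))"
proof -
  obtain b r where b: "poly_bound r" "mono r" "computes_at 1 b r h" using poly_timeE[OF assms(1)] .
  obtain c p where c: "poly_bound p" "mono p" "computes_at 0 c p f" using poly_timeE[OF assms(2)] .
  obtain d q where d: "poly_bound q" "mono q" "computes_at 0 d q g" using poly_timeE[OF assms(3)] .
  show ?thesis
  proof (rule poly_timeI)
    show "poly_bound (\<lambda>n. (1 + n) + (r n + (2 + p n + q n)))"
      by (intro poly_bound_intros b c d)
    fix x
    let ?S = "(\<lambda>_. Leaf)(0 := x) :: store"
    let ?S1 = "?S(1 := x)"  let ?S2 = "?S(1 := h x)"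
    let ?v = "tif (h x) (f x) (g x)"
    have e1: "exec (Assign 1 (Var 0)) ?S (1 + size x) ?S1" by (rule exec_Assign') auto
    obtain t1 where t1: "exec b ?S1 t1 ?S2" "t1 \<le> r (size x)"
      using computes_atD[OF b(3), of ?S1] by auto
    \<comment> \<open>A call at register 0 expects register 1 to be empty, but on the true branch it
      still holds the value of the test.\<close>
    have e0: "exec (Assign 1 Empty) ?S2 1 ?S" by (rule exec_Assign') auto
    obtain t2 where t2: "exec c ?S t2 (?S(0 := f x))" "t2 \<le> p (size x)"
      using computes_atD[OF c(3), of ?S] by auto
    obtain t3 where t3: "exec d ?S t3 (?S(0 := g x))" "t3 \<le> q (size x)"
      using computes_atD[OF d(3), of ?S] by auto
    have "\<exists>t s. exec (If 1 (Seq (Assign 1 Empty) c) d) ?S2 t s \<and> s 0 = ?v \<and>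
        t \<le> 2 + p (size x) + q (size x)"
    proof (cases "h x = Leaf")
      case True
      then have "?S2 = ?S" by auto
      then have "exec (If 1 (Seq (Assign 1 Empty) c) d) ?S2 (1 + t3) (?S(0 := g x))"
        using True t3 exec.IfFalse[of ?S2 1 d t3] by simp
      then show ?thesis by (rule runsI) (use True t3 in \<open>auto simp: tif_def\<close>)
    next
      case False
      then have "exec (If 1 (Seq (Assign 1 Empty) c) d) ?S2 (1 + (1 + t2)) (?S(0 := f x))"
        using exec.IfTrue[of ?S2 1, OF _ exec.Seq[OF e0 t2(1)]] by simp
      then show ?thesis by (rule runsI) (use False t2 in \<open>auto simp: tif_def\<close>)
    qed
    then obtain t s where ts: "exec (If 1 (Seq (Assign 1 Empty) c) d) ?S2 t s" "s 0 = ?v"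
        "t \<le> 2 + p (size x) + q (size x)" by blast
    show "\<exists>t s. exec (Seq (Assign 1 (Var 0)) (Seq b (If 1 (Seq (Assign 1 Empty) c) d))) ?S t s \<and>
        s 0 = ?v \<and> t \<le> (1 + size x) + (r (size x) + (2 + p (size x) + q (size x)))"
      by (rule runsI, rule exec.Seq[OF e1 exec.Seq[OF t1(1) ts(1)]]) (use t1(2) ts in auto)
  qed
qed


text \<open>Reading every tree as the list of trees hanging off its right spine makes all functions below
  total, so that they are polynomially bounded on malformed inputs as well.\<close>

fun dec_list :: "tree \<Rightarrow> tree list" where
  "dec_list Leaf = []"
| "dec_list (Node x xs) = x # dec_list xs"

lemma dec_enc_list [simp]: "dec_list (enc_list e xs) = map e xs"
  by (induction xs) auto

lemma enc_dec_list [simp]: "enc_list (\<lambda>x. x) (dec_list t) = t"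
  by (induction t rule: dec_list.induct) auto

lemma enc_list_map: "enc_list e (map f xs) = enc_list (\<lambda>x. e (f x)) xs"
  by (induction xs) auto

lemma enc_list_cong: "(\<And>x. x \<in> set xs \<Longrightarrow> e x = e' x) \<Longrightarrow> enc_list e xs = enc_list e' xs"
  by (induction xs) auto

lemma enc_list_eq_Leaf [simp]: "enc_list e xs = Leaf \<longleftrightarrow> xs = []"
  by (cases xs) auto

lemma length_dec_list_le: "length (dec_list t) \<le> size t"
  by (induction t rule: dec_list.induct) auto

lemma size_enc_list: "size (enc_list e xs) = (\<Sum>x\<leftarrow>xs. Suc (size (e x)))"
  by (induction xs) auto

lemma size_mem_dec_list: "x \<in> set (dec_list t) \<Longrightarrow> size x \<le> size t"
  by (induction t rule: dec_list.induct) auto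

text \<open>The one loop of the development: the list \<open>l x\<close> is consumed in register 1
  as a counter, register 2 accumulates. The bound on all intermediate values is essential, as a time
  bound on \<open>F\<close> alone would admit repeated doubling.\<close>

lemma poly_time_iterate:
  assumes F: "poly_time F" and l: "poly_time l" and a: "poly_time a" and b: "poly_bound b"
    and bound: "\<And>x j. j \<le> length (dec_list (l x)) \<Longrightarrow> size ((F ^^ j) (a x)) \<le> b (size x)"
  shows "poly_time (\<lambda>x. (F ^^ length (dec_list (l x))) (a x))"
proof -
  obtain c p where c: "poly_bound p" "mono p" "computes_at 2 c p F" using poly_timeE[OF F] .
  obtain d q where d: "poly_bound q" "mono q" "computes_at 1 d q l" using poly_timeE[OF l] .
  obtain e r where e: "poly_bound r" "mono r" "computes_at 2 e r a" using poly_timeE[OF a] .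
  obtain q' where q': "poly_bound q'" "mono q'" "\<forall>x. size (l x) \<le> q' (size x)"
    using poly_time_size[OF l] .
  let ?B = "Seq (Assign 1 (Snd 1)) c"
  let ?W = "While 1 ?B"
  show ?thesis
  proof (rule poly_timeI)
    show "poly_bound (\<lambda>n. (1 + n) + (q n + ((1 + n) + (r n +
        ((1 + q' n * (2 + q' n + p (b n))) + (1 + b n))))))"
      by (intro poly_bound_intros poly_bound_compose[OF c(1) b] c d e q' b)
    fix x
    let ?S = "(\<lambda>_. Leaf)(0 := x) :: store"
    let ?v = "(F ^^ length (dec_list (l x))) (a x)"
    \<comment> \<open>The store at the head of the loop, with remaining counter \<open>u\<close> and
      accumulator \<open>z\<close>; register 0 keeps the input.\<close>
    define T where "T u z = ?S(1 := u, 2 := z)" for u z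
    have T1: "T u z 1 = u" and T2: "T u z 2 = z" and T_Leaf: "j > 2 \<Longrightarrow> T u z j = Leaf"
      and T_upd: "(T u z)(2 := w) = T u w" "(T u z)(1 := w) = T w z" for u z w j
      by (auto simp: T_def fun_eq_iff)
    have loop: "\<exists>t. exec ?W (T u z) t (T Leaf ((F ^^ length (dec_list u)) z)) \<and>
        t \<le> 1 + length (dec_list u) * (2 + q' (size x) + p (b (size x)))"
      if "size u \<le> q' (size x)"
        "\<And>j. j \<le> length (dec_list u) \<Longrightarrow> size ((F ^^ j) z) \<le> b (size x)" for u z
      using that
    proof (induction u arbitrary: z rule: dec_list.induct)
      case 1
      show ?case
        using exec.WhileFalse[of "T Leaf z" 1 ?B] T1 by (intro exI[of _ 1]) simp
    next
      case (2 y u)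
      have e1: "exec (Assign 1 (Snd 1)) (T (Node y u) z) (1 + size (Node y u)) (T u z)"
        by (rule exec_Assign') (auto simp: T1[simplified] T_upd[simplified])
      obtain t1 where t1: "exec c (T u z) t1 (T u (F z))" "t1 \<le> p (size z)"
        using computes_atD[OF c(3), of "T u z"] by (auto simp: T2 T_Leaf T_upd)
      have "size z \<le> b (size x)" using 2(3)[of 0] by simp
      then have t1': "t1 \<le> p (b (size x))" using c(2) t1(2) by (meson le_trans monoD)
      have "size ((F ^^ j) (F z)) \<le> b (size x)" if "j \<le> length (dec_list u)" for j
        using 2(3)[of "Suc j"] that by (simp add: funpow_swap1)
      then obtain t2 where t2: "exec ?W (T u (F z)) t2 (T Leaf ((F ^^ length (dec_list u)) (F z)))"
          "t2 \<le> 1 + length (dec_list u) * (2 + q' (size x) + p (b (size x)))"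
        using 2(1)[of "F z"] 2(2) by auto
      have "exec ?W (T (Node y u) z) (1 + ((1 + size (Node y u)) + t1) + t2)
          (T Leaf ((F ^^ length (dec_list u)) (F z)))"
        by (rule exec.WhileTrue[OF _ exec.Seq[OF e1 t1(1)] t2(1)]) (simp add: T1[simplified])
      moreover have "1 + ((1 + size (Node y u)) + t1) + t2 \<le>
          1 + length (dec_list (Node y u)) * (2 + q' (size x) + p (b (size x)))"
        using t1' t2(2) 2(2) by simp
      ultimately show ?case by (auto simp: funpow_swap1)
    qed
    have e1: "exec (Assign 1 (Var 0)) ?S (1 + size x) (?S(1 := x))" by (rule exec_Assign') auto
    obtain t1 where t1: "exec d (?S(1 := x)) t1 (?S(1 := l x))" "t1 \<le> q (size x)"
      using computes_atD[OF d(3), of "?S(1 := x)"] by auto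
    have e2: "exec (Assign 2 (Var 0)) (?S(1 := l x)) (1 + size x) (T (l x) x)"
      by (rule exec_Assign') (auto simp: T_def)
    obtain t2 where t2: "exec e (T (l x) x) t2 (T (l x) (a x))" "t2 \<le> r (size x)"
      using computes_atD[OF e(3), of "T (l x) x"] by (auto simp: T2 T_Leaf T_upd)
    have "\<exists>t. exec ?W (T (l x) (a x)) t (T Leaf ?v) \<and>
        t \<le> 1 + length (dec_list (l x)) * (2 + q' (size x) + p (b (size x)))"
      by (rule loop[OF q'(3)[rule_format] bound])
    then obtain t3 where t3: "exec ?W (T (l x) (a x)) t3 (T Leaf ?v)"
        "t3 \<le> 1 + length (dec_list (l x)) * (2 + q' (size x) + p (b (size x)))" by blast
    have "length (dec_list (l x)) \<le> q' (size x)"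
      using length_dec_list_le[of "l x"] q'(3)[THEN spec, of x] by linarith
    then have t3': "t3 \<le> 1 + q' (size x) * (2 + q' (size x) + p (b (size x)))"
      using t3(2) by (meson add_left_mono le_trans mult_right_mono zero_le)
    have e3: "exec (Assign 0 (Var 2)) (T Leaf ?v) (1 + size ?v) ((T Leaf ?v)(0 := ?v))"
      by (rule exec_Assign') (auto simp: T2)
    have v: "size ?v \<le> b (size x)" by (rule bound) simp
    show "\<exists>t s. exec (Seq (Assign 1 (Var 0)) (Seq d (Seq (Assign 2 (Var 0)) (Seq e
          (Seq ?W (Assign 0 (Var 2))))))) ?S t s \<and> s 0 = ?v \<and>
        t \<le> (1 + size x) + (q (size x) + ((1 + size x) + (r (size x) +
          ((1 + q' (size x) * (2 + q' (size x) + p (b (size x)))) + (1 + b (size x))))))"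
      by (rule runsI, rule exec.Seq[OF e1 exec.Seq[OF t1(1) exec.Seq[OF e2
            exec.Seq[OF t2(1) exec.Seq[OF t3(1) e3]]]]])
        (use t1(2) t2(2) t3' v in auto)
  qed
qed

text \<open>A loop eats a list from the front, whereas \<open>foldr\<close> combines from the back;
  reversing first reconciles them. The state pairs the rest of the list with the reversed part, and
  its size stays constant.\<close>

lemma poly_time_rev:
  assumes "poly_time l"
  shows "poly_time (\<lambda>x. enc_list (\<lambda>y. y) (rev (dec_list (l x))))"
proof -
  define F where "F z = Node (right (left z)) (Node (left (left z)) (right z))" for z
  have F: "poly_time F"
    unfolding F_def by (intro poly_time_Node poly_time_left poly_time_right poly_time_id)
  have F_Node: "F (Node (Node y t) u) = Node t (Node y u)" for y t u by (simp add: F_def)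
  have step: "(F ^^ j) (Node (enc_list (\<lambda>y. y) ys) (enc_list (\<lambda>y. y) zs)) =
      Node (enc_list (\<lambda>y. y) (drop j ys)) (enc_list (\<lambda>y. y) (rev (take j ys) @ zs))"
    if "j \<le> length ys" for j ys zs
    using that
  proof (induction j arbitrary: ys zs)
    case (Suc j)
    then obtain y ys' where "ys = y # ys'" by (cases ys) auto
    with Suc.IH[of ys' "y # zs"] Suc.prems show ?case
      by (simp add: funpow_Suc_right F_Node del: funpow.simps(2))
  qed simp
  have step': "(F ^^ j) (Node t Leaf) = Node (enc_list (\<lambda>y. y) (drop j (dec_list t)))
      (enc_list (\<lambda>y. y) (rev (take j (dec_list t))))"
    if "j \<le> length (dec_list t)" for j t
    using step[OF that, of "[]"] by simp
  obtain q where q: "poly_bound q" "mono q" "\<forall>x. size (l x) \<le> q (size x)"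
    using poly_time_size[OF assms] .
  have "poly_time (\<lambda>x. right ((F ^^ length (dec_list (l x))) (Node (l x) Leaf)))"
  proof (rule poly_time_right, rule poly_time_iterate[OF F assms])
    show "poly_time (\<lambda>x. Node (l x) Leaf)" by (intro poly_time_Node assms poly_time_const)
    show "poly_bound (\<lambda>n. 1 + q n)" by (intro poly_bound_intros q)
    fix x j assume j: "j \<le> length (dec_list (l x))"
    have "size (l x) = (\<Sum>y\<leftarrow>take j (dec_list (l x)) @ drop j (dec_list (l x)). Suc (size y))"
      using size_enc_list[of "\<lambda>y. y" "dec_list (l x)"] by simp
    then have "size ((F ^^ j) (Node (l x) Leaf)) = Suc (size (l x))"
      unfolding step'[OF j] by (simp add: size_enc_list sum_list_rev flip: rev_map del: append_take_drop_id)
    then show "size ((F ^^ j) (Node (l x) Leaf)) \<le> 1 + q (size x)" using q(3) by simp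
  qed
  then show ?thesis by (simp add: step')
qed

text \<open>Tree functions have no closures, so the environment \<open>e\<close> carries the free
  variables of the folded function and travels in the loop state next to the accumulator. The bound
  is asked for every list because intermediate accumulators are folds over suffixes of
  \<open>l e\<close>.\<close>

lemma poly_time_foldr:
  assumes l: "poly_time l" and a: "poly_time a"
    and g: "poly_time (\<lambda>z. g (left z) (left (right z)) (right (right z)))"
    and b: "poly_bound b"
    and bound: "\<And>e ys. size (foldr (\<lambda>y acc. g y acc e) ys (a e)) \<le>
      b (size (enc_list (\<lambda>y. y) ys) + size e)"
  shows "poly_time (\<lambda>e. foldr (\<lambda>y acc. g y acc e) (dec_list (l e)) (a e))"
proof -
  define F where "F z = Node (right (left z))
      (Node (g (left (left z)) (left (right z)) (right (right z))) (right (right z)))" for z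
  define r where "r x = enc_list (\<lambda>y. y) (rev (dec_list (l x)))" for x
  have r: "poly_time r" unfolding r_def by (rule poly_time_rev[OF l])
  have "poly_time (\<lambda>z. (\<lambda>z. g (left z) (left (right z)) (right (right z)))
      (Node (left (left z)) (right z)))"
    by (rule poly_time_compose[OF g]) (intro poly_time_Node poly_time_left poly_time_right poly_time_id)
  then have F: "poly_time F"
    unfolding F_def by (intro poly_time_Node poly_time_left poly_time_right poly_time_id) simp
  have F_Node: "F (Node (Node y t) (Node acc e)) = Node t (Node (g y acc e) e)" for y t acc e
    by (simp add: F_def)
  have step: "(F ^^ j) (Node (enc_list (\<lambda>y. y) ys) (Node acc e)) =
      Node (enc_list (\<lambda>y. y) (drop j ys)) (Node (fold (\<lambda>y acc. g y acc e) (take j ys) acc) e)"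
    if "j \<le> length ys" for j ys acc e
    using that
  proof (induction j arbitrary: ys acc)
    case (Suc j)
    then obtain y ys' where "ys = y # ys'" by (cases ys) auto
    with Suc.IH[of ys' "g y acc e"] Suc.prems show ?case
      by (simp add: funpow_Suc_right F_Node del: funpow.simps(2))
  qed simp
  have step': "(F ^^ j) (Node (r e) (Node acc e)) =
      Node (enc_list (\<lambda>y. y) (drop j (rev (dec_list (l e)))))
        (Node (foldr (\<lambda>y acc. g y acc e) (drop (length (dec_list (l e)) - j) (dec_list (l e))) acc) e)"
    if "j \<le> length (dec_list (l e))" for j acc e
    using step[of j "rev (dec_list (l e))"] that
    by (simp add: r_def foldr_conv_fold rev_drop)
  have len: "length (dec_list (r e)) = length (dec_list (l e))" for e
    by (simp add: r_def)
  have size_drop: "size (enc_list (\<lambda>y. y) (drop j ys)) \<le> size (enc_list (\<lambda>y. y) ys)" for j and ys :: "tree list"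
    by (induction ys arbitrary: j) (auto simp: drop_Cons split: nat.split intro: le_SucI trans_le_add2)
  obtain q where q: "poly_bound q" "mono q" "\<forall>x. size (l x) \<le> q (size x)"
    using poly_time_size[OF l] .
  obtain q' where q': "poly_bound q'" "mono q'" "\<forall>x. size (r x) \<le> q' (size x)"
    using poly_time_size[OF r] .
  \<comment> \<open>A monotone majorant is required, since the bound gets evaluated at an estimate
    of the size of the suffix.\<close>
  obtain b' where b': "poly_bound b'" "mono b'" "\<forall>n. b n \<le> b' n"
    using poly_bound_monoE[OF b] .
  have "poly_time (\<lambda>e. left (right ((F ^^ length (dec_list (r e))) (Node (r e) (Node (a e) e)))))"
  proof (rule poly_time_left, rule poly_time_right, rule poly_time_iterate[OF F r])
    show "poly_time (\<lambda>e. Node (r e) (Node (a e) e))"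
      by (intro poly_time_Node r a poly_time_id)
    have "poly_bound (\<lambda>n. b' (q n + n))"
      by (rule poly_bound_compose[OF b'(1)]) (intro poly_bound_intros q)
    then show "poly_bound (\<lambda>n. q' n + (b' (q n + n) + n + 2))"
      by (intro poly_bound_intros q')
    fix e j assume "j \<le> length (dec_list (r e))"
    then have j: "j \<le> length (dec_list (l e))" by (simp add: len)
    let ?ys = "drop (length (dec_list (l e)) - j) (dec_list (l e))"
    have "size (enc_list (\<lambda>y. y) ?ys) \<le> size (l e)"
      using size_drop[of _ "dec_list (l e)"] by simp
    then have "b (size (enc_list (\<lambda>y. y) ?ys) + size e) \<le> b' (q (size e) + size e)"
      using b'(3)[rule_format, of "size (enc_list (\<lambda>y. y) ?ys) + size e"] q(3)[rule_format, of e]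
        monoD[OF b'(2), of "size (enc_list (\<lambda>y. y) ?ys) + size e" "q (size e) + size e"] by linarith
    from le_trans[OF bound this] have "size (foldr (\<lambda>y acc. g y acc e) ?ys (a e)) \<le> b' (q (size e) + size e)"
      .
    moreover have "size (enc_list (\<lambda>y. y) (drop j (rev (dec_list (l e))))) \<le> q' (size e)"
      using size_drop[of j "rev (dec_list (l e))"] q'(3)[rule_format, of e] unfolding r_def by linarith
    ultimately show "size ((F ^^ j) (Node (r e) (Node (a e) e))) \<le>
        q' (size e) + (b' (q (size e) + size e) + size e + 2)"
      unfolding step'[OF j] by simp
  qed
  then show ?thesis unfolding len by (simp add: step')
qed

section \<open>Polynomial-time list functions\<close>

definition tmap :: "(tree \<Rightarrow> tree) \<Rightarrow> tree \<Rightarrow> tree" where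
  "tmap f l = enc_list f (dec_list l)"

lemma foldr_Node: "foldr (\<lambda>y acc. Node (f y) acc) ys Leaf = enc_list f ys"
  by (induction ys) auto

lemma sum_list_le:
  fixes f :: "'a \<Rightarrow> nat"
  assumes "\<And>x. x \<in> set xs \<Longrightarrow> f x \<le> c"
  shows "(\<Sum>x\<leftarrow>xs. f x) \<le> length xs * c"
  using assms by (induction xs) (auto simp: add_mono)

text \<open>\<open>g\<close> also receives the ambient tree \<open>e\<close>, which lets maps be
  nested: an inner function sees the current outer element through the environment.\<close>

lemma poly_time_tmap:
  assumes l: "poly_time l" and g: "poly_time (\<lambda>z. g (left z) (right z))"
  shows "poly_time (\<lambda>e. tmap (\<lambda>y. g y e) (l e))"
proof -
  obtain q where q: "poly_bound q" "mono q" "\<forall>z. size (g (left z) (right z)) \<le> q (size z)"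
    using poly_time_size[OF g] .
  have "poly_time (\<lambda>e. foldr (\<lambda>y acc. Node (g y e) acc) (dec_list (l e)) Leaf)"
  proof (rule poly_time_foldr[OF l poly_time_const])
    have "poly_time (\<lambda>z. (\<lambda>z. g (left z) (right z)) (Node (left z) (right (right z))))"
      by (rule poly_time_compose[OF g]) (intro poly_time_Node poly_time_left poly_time_right poly_time_id)
    then show "poly_time (\<lambda>z. Node (g (left z) (right (right z))) (left (right z)))"
      by (intro poly_time_Node poly_time_left poly_time_right poly_time_id) simp
    have "poly_bound (\<lambda>n. q (n + 1))"
      by (rule poly_bound_compose[OF q(1)]) (intro poly_bound_intros)
    then show "poly_bound (\<lambda>n. n * (q (n + 1) + 1))" by (intro poly_bound_intros)
    fix e :: tree and ys :: "tree list"
    let ?n = "size (enc_list (\<lambda>y. y) ys) + size e"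
    have "size (g y e) \<le> q (?n + 1)" if "y \<in> set ys" for y
    proof -
      have "size y \<le> size (enc_list (\<lambda>y. y) ys)"
        using that size_mem_dec_list[of y "enc_list (\<lambda>y. y) ys"] by simp
      then have "size (Node y e) \<le> ?n + 1" by simp
      from le_trans[OF q(3)[rule_format] monoD[OF q(2) this]] show ?thesis by simp
    qed
    then have "size (enc_list (\<lambda>y. g y e) ys) \<le> length ys * (q (?n + 1) + 1)"
      unfolding size_enc_list by (intro sum_list_le) auto
    also have "\<dots> \<le> ?n * (q (?n + 1) + 1)"
      using length_dec_list_le[of "enc_list (\<lambda>y. y) ys"] by (intro mult_right_mono) auto
    finally show "size (foldr (\<lambda>y acc. Node (g y e) acc) ys Leaf) \<le> ?n * (q (?n + 1) + 1)"
      by (simp add: foldr_Node)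
  qed
  then show ?thesis by (simp add: foldr_Node tmap_def)
qed

lemma tmap_enc_list [simp]: "tmap f (enc_list e xs) = enc_list (\<lambda>x. f (e x)) xs"
  by (simp add: tmap_def enc_list_map)

definition tappend :: "tree \<Rightarrow> tree \<Rightarrow> tree" where
  "tappend s t = foldr Node (dec_list s) t"

lemma size_tappend: "size (tappend s t) = size s + size t"
  unfolding tappend_def by (induction s rule: dec_list.induct) auto

lemma tappend_enc_list [simp]:
  "tappend (enc_list e xs) (enc_list e ys) = enc_list e (xs @ ys)"
  unfolding tappend_def by (induction xs) auto

lemma foldr_Node_eq_tappend: "foldr Node ys t = tappend (enc_list (\<lambda>y. y) ys) t"
  by (simp add: tappend_def)

lemma poly_time_tappend:
  assumes "poly_time f" "poly_time g"
  shows "poly_time (\<lambda>x. tappend (f x) (g x))"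
proof -
  have "poly_time (\<lambda>z. tappend (left z) (right z))"
    unfolding tappend_def
  proof (rule poly_time_foldr[where g = "\<lambda>y acc e. Node y acc"])
    show "poly_bound (\<lambda>n. n)" by (rule poly_bound_id)
    show "size (foldr Node ys (right e)) \<le> size (enc_list (\<lambda>y. y) ys) + size e" for e ys
      using size_right[of e] by (simp add: foldr_Node_eq_tappend size_tappend)
  qed (intro poly_time_Node poly_time_left poly_time_right poly_time_id)+
  then have "poly_time (\<lambda>x. (\<lambda>z. tappend (left z) (right z)) (Node (f x) (g x)))"
    by (rule poly_time_compose) (intro poly_time_Node assms)
  then show ?thesis by simp
qed

lemma poly_time_apply2:
  assumes "poly_time (\<lambda>z. F (left z) (right z))" "poly_time f" "poly_time g"
  shows "poly_time (\<lambda>x. F (f x) (g x))"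
proof -
  have "poly_time (\<lambda>x. (\<lambda>z. F (left z) (right z)) (Node (f x) (g x)))"
    by (rule poly_time_compose[OF assms(1)]) (intro poly_time_Node assms)
  then show ?thesis by simp
qed

lemmas poly_time_basic =
  poly_time_id poly_time_const poly_time_left poly_time_right poly_time_Node poly_time_tif
  poly_time_tmap poly_time_tappend

section \<open>Unary indices, table lookup and truth values\<close>

primrec unary :: "nat \<Rightarrow> tree" where
  "unary 0 = Leaf"
| "unary (Suc n) = Node Leaf (unary n)"

lemma length_dec_list_unary [simp]: "length (dec_list (unary n)) = n"
  by (induction n) auto

lemma size_unary [simp]: "size (unary n) = n"
  by (induction n) auto

lemma unary_eq_Leaf [simp]: "unary n = Leaf \<longleftrightarrow> n = 0"
  by (cases n) auto

text \<open>Any tree \<open>u\<close> is read as a unary number, namely the length of its right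
  spine.\<close>

definition tdrop :: "tree \<Rightarrow> tree \<Rightarrow> tree" where
  "tdrop u l = (right ^^ length (dec_list u)) l"

lemma funpow_right_enc_list: "(right ^^ j) (enc_list e xs) = enc_list e (drop j xs)"
proof (induction j arbitrary: xs)
  case (Suc j)
  from Suc[of "[]"] Suc show ?case by (cases xs) (auto simp: funpow_swap1)
qed simp

lemma tdrop_enc_list: "tdrop u (enc_list e xs) = enc_list e (drop (length (dec_list u)) xs)"
  by (simp add: tdrop_def funpow_right_enc_list)

lemma tdrop_eq_Leaf: "tdrop u l = Leaf \<longleftrightarrow> length (dec_list l) \<le> length (dec_list u)"
  using tdrop_enc_list[of u "\<lambda>x. x" "dec_list l"] by simp

lemma poly_time_tdrop:
  assumes "poly_time f" "poly_time g"
  shows "poly_time (\<lambda>x. tdrop (f x) (g x))"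
proof (rule poly_time_apply2[OF _ assms])
  have "size ((right ^^ j) t) \<le> size t" for j t
    by (induction j) (auto intro: le_trans[OF size_right])
  then have "size ((right ^^ j) (right x)) \<le> size x" for j x
    using size_right le_trans by blast
  then show "poly_time (\<lambda>z. tdrop (left z) (right z))"
    unfolding tdrop_def by (intro poly_time_iterate[where b = "\<lambda>n. n"] poly_time_basic poly_bound_id)
qed

definition tnth :: "tree \<Rightarrow> tree \<Rightarrow> tree" where
  "tnth u l = left (tdrop u l)"

lemma tnth_table [simp]:
  assumes "i < n"
  shows "tnth (unary i) (enc_table n f) = f i"
proof -
  have "drop i [0..<n] = i # [Suc i..<n]" by (simp only: drop_upt add_0 upt_conv_Cons[OF assms])
  then show ?thesis by (simp add: tnth_def enc_table_def tdrop_enc_list)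
qed

lemma poly_time_tnth:
  "poly_time f \<Longrightarrow> poly_time g \<Longrightarrow> poly_time (\<lambda>x. tnth (f x) (g x))"
  unfolding tnth_def by (intro poly_time_left poly_time_tdrop)

lemma enc_bool_eq_Leaf [simp]: "enc_bool b = Leaf \<longleftrightarrow> \<not> b"
  by (simp add: enc_bool_def)

lemma tif_enc_bool [simp]: "tif (enc_bool b) s t = (if b then s else t)"
  by (simp add: tif_def)

text \<open>Equality of lengths: dropping either list by the length of the other leaves
  nothing.\<close>

definition teq :: "tree \<Rightarrow> tree \<Rightarrow> tree" where
  "teq u v = tif (tdrop u v) Leaf (tif (tdrop v u) Leaf (enc_bool True))"

lemma teq_unary [simp]: "teq (unary i) (unary j) = enc_bool (i = j)"
  by (auto simp: teq_def tif_def tdrop_eq_Leaf enc_bool_def)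

lemma poly_time_teq:
  "poly_time f \<Longrightarrow> poly_time g \<Longrightarrow> poly_time (\<lambda>x. teq (f x) (g x))"
  unfolding teq_def by (intro poly_time_basic poly_time_tdrop)

definition tor :: "tree \<Rightarrow> tree \<Rightarrow> tree" where
  "tor s t = tif s (enc_bool True) t"

definition tand :: "tree \<Rightarrow> tree \<Rightarrow> tree" where
  "tand s t = tif s t Leaf"

definition tnot :: "tree \<Rightarrow> tree" where
  "tnot s = tif s Leaf (enc_bool True)"

lemma tor_enc_bool [simp]: "tor (enc_bool a) (enc_bool b) = enc_bool (a \<or> b)"
  by (simp add: tor_def)

lemma tand_enc_bool [simp]: "tand (enc_bool a) (enc_bool b) = enc_bool (a \<and> b)"
  by (simp add: tand_def enc_bool_def tif_def)

lemma tnot_enc_bool [simp]: "tnot (enc_bool a) = enc_bool (\<not> a)"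
  by (simp add: tnot_def enc_bool_def tif_def)

lemma poly_time_connectives:
  "poly_time f \<Longrightarrow> poly_time g \<Longrightarrow> poly_time (\<lambda>x. tor (f x) (g x))"
  "poly_time f \<Longrightarrow> poly_time g \<Longrightarrow> poly_time (\<lambda>x. tand (f x) (g x))"
  "poly_time f \<Longrightarrow> poly_time (\<lambda>x. tnot (f x))"
  unfolding tor_def tand_def tnot_def by (intro poly_time_basic; assumption)+

definition tany :: "tree \<Rightarrow> tree" where
  "tany l = foldr (\<lambda>y acc. tif y (enc_bool True) acc) (dec_list l) Leaf"

lemma tany_enc_list [simp]:
  "tany (enc_list (\<lambda>x. enc_bool (P x)) xs) = enc_bool (\<exists>x\<in>set xs. P x)"
  unfolding tany_def by (induction xs) (auto simp: enc_bool_def tif_def)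

lemma poly_time_tany:
  assumes "poly_time f"
  shows "poly_time (\<lambda>x. tany (f x))"
  unfolding tany_def
proof (rule poly_time_foldr[where g = "\<lambda>y acc e. tif y (enc_bool True) acc" and b = "\<lambda>_. 1"])
  show "size (foldr (\<lambda>y acc. tif y (enc_bool True) acc) ys Leaf) \<le> 1" for ys
    by (induction ys) (auto simp: tif_def enc_bool_def)
qed (intro assms poly_time_basic poly_bound_const)+

text \<open>Turns a size that is present only as the length of a table into the list of its unary
  indices, by putting 0 in front and incrementing the rest.\<close>

definition iota :: "tree \<Rightarrow> tree" where
  "iota l = foldr (\<lambda>y acc. Node Leaf (tmap (Node Leaf) acc)) (dec_list l) Leaf"

lemma foldr_iota:
  "foldr (\<lambda>y acc. Node Leaf (tmap (Node Leaf) acc)) ys Leaf = enc_list unary [0..<length ys]"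
proof (induction ys)
  case (Cons y ys)
  have "enc_list unary [0..<Suc n] = Node Leaf (enc_list (\<lambda>i. Node Leaf (unary i)) [0..<n])" for n
    by (subst upt_rec) (simp add: enc_list_map del: upt_Suc flip: map_Suc_upt)
  with Cons show ?case by (simp del: upt_Suc)
qed simp

lemma iota_eq: "iota l = enc_list unary [0..<length (dec_list l)]"
  by (simp add: iota_def foldr_iota)

lemma poly_time_iota:
  assumes "poly_time f"
  shows "poly_time (\<lambda>x. iota (f x))"
  unfolding iota_def
proof (rule poly_time_foldr[where g = "\<lambda>y acc e. Node Leaf (tmap (Node Leaf) acc)"])
  show "poly_bound (\<lambda>n. n * (n + 1))" by (intro poly_bound_intros)
  fix e :: tree and ys :: "tree list"
  let ?n = "size (enc_list (\<lambda>y. y) ys) + size e"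
  have n: "length ys \<le> ?n" using length_dec_list_le[of "enc_list (\<lambda>y. y) ys"] by simp
  have "size (enc_list unary [0..<length ys]) \<le> length [0..<length ys] * (?n + 1)"
    unfolding size_enc_list[of unary] by (rule sum_list_le) (use n in auto)
  also have "\<dots> \<le> ?n * (?n + 1)" using n by (intro mult_right_mono) auto
  finally show "size (foldr (\<lambda>y acc. Node Leaf (tmap (Node Leaf) acc)) ys Leaf) \<le> ?n * (?n + 1)"
    by (simp only: foldr_iota)
qed (intro assms poly_time_basic)+

text \<open>The pairs come in the order of \<open>List.product\<close>, so that positions agree with
  those in \<open>cells\<close>.\<close>

definition tproduct :: "tree \<Rightarrow> tree \<Rightarrow> tree" where
  "tproduct s t = foldr (\<lambda>x acc. tappend (tmap (\<lambda>y. Node x y) t) acc) (dec_list s) Leaf"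

lemma tproduct_enc_list [simp]:
  "tproduct (enc_list e xs) (enc_list e' ys) =
     enc_list (\<lambda>(x, y). Node (e x) (e' y)) (List.product xs ys)"
proof -
  have "tappend (enc_list (\<lambda>y. Node (e x) (e' y)) ys) (enc_list (\<lambda>(x, y). Node (e x) (e' y)) zs) =
      enc_list (\<lambda>(x, y). Node (e x) (e' y)) (map (Pair x) ys @ zs)" for x zs
    using tappend_enc_list[of "\<lambda>(x, y). Node (e x) (e' y)" "map (Pair x) ys" zs]
    by (simp add: enc_list_map)
  then show ?thesis unfolding tproduct_def by (induction xs) auto
qed

lemma poly_time_tproduct:
  assumes "poly_time f" "poly_time g"
  shows "poly_time (\<lambda>x. tproduct (f x) (g x))"
proof (rule poly_time_apply2[OF _ assms])
  show "poly_time (\<lambda>z. tproduct (left z) (right z))"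
    unfolding tproduct_def
  proof (rule poly_time_foldr[where g = "\<lambda>x acc e. tappend (tmap (\<lambda>y. Node x y) (right e)) acc"])
    show "poly_bound (\<lambda>n. n * (n * (2 * n + 2)))" by (intro poly_bound_intros)
    fix e :: tree and xs :: "tree list"
    let ?n = "size (enc_list (\<lambda>y. y) xs) + size e"
    have xs: "length xs \<le> ?n" using length_dec_list_le[of "enc_list (\<lambda>y. y) xs"] by simp
    have row: "size (tmap (\<lambda>y. Node x y) (right e)) \<le> ?n * (2 * ?n + 2)" if "x \<in> set xs" for x
    proof -
      have x: "size x \<le> ?n" using that size_mem_dec_list[of x "enc_list (\<lambda>y. y) xs"] by simp
      have "size y \<le> ?n" if "y \<in> set (dec_list (right e))" for y
        using size_mem_dec_list[OF that] size_right[of e] by simp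
      with x have "size (tmap (\<lambda>y. Node x y) (right e)) \<le> length (dec_list (right e)) * (2 * ?n + 2)"
        unfolding tmap_def size_enc_list by (intro sum_list_le) fastforce
      also have "\<dots> \<le> ?n * (2 * ?n + 2)"
        using length_dec_list_le[of "right e"] size_right[of e] by (intro mult_right_mono) auto
      finally show ?thesis .
    qed
    have "size (foldr (\<lambda>x acc. tappend (tmap (\<lambda>y. Node x y) (right e)) acc) zs Leaf) \<le>
        length zs * (?n * (2 * ?n + 2))" if "set zs \<subseteq> set xs" for zs
      using that
    proof (induction zs)
      case (Cons z zs)
      then show ?case using row[of z] by (simp add: size_tappend)
    qed simp
    from this[of xs]
    have "size (foldr (\<lambda>x acc. tappend (tmap (\<lambda>y. Node x y) (right e)) acc) xs Leaf) \<le>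
        length xs * (?n * (2 * ?n + 2))" by simp
    also have "\<dots> \<le> ?n * (?n * (2 * ?n + 2))" using xs by (intro mult_right_mono) auto
    finally show "size (foldr (\<lambda>x acc. tappend (tmap (\<lambda>y. Node x y) (right e)) acc) xs Leaf) \<le>
        ?n * (?n * (2 * ?n + 2))" .
  qed (intro poly_time_basic)+
qed

text \<open>The Horner step of the conversion from binary: twice the unary number plus the
  digit.\<close>

definition tdouble :: "tree \<Rightarrow> tree \<Rightarrow> tree" where
  "tdouble b u = foldr (\<lambda>y acc. Node Leaf (Node Leaf acc)) (dec_list u) (tif b (unary 1) Leaf)"

lemma foldr_double:
  "foldr (\<lambda>y acc. Node Leaf (Node Leaf acc)) ys (tif b (unary 1) Leaf) =
     unary (2 * length ys + (if b = Leaf then 0 else 1))"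
  by (induction ys) (auto simp: tif_def)

lemma tdouble_eq: "tdouble b u = unary (2 * length (dec_list u) + (if b = Leaf then 0 else 1))"
  by (simp only: tdouble_def foldr_double)

lemma poly_time_tdouble:
  assumes "poly_time f" "poly_time g"
  shows "poly_time (\<lambda>x. tdouble (f x) (g x))"
proof (rule poly_time_apply2[OF _ assms])
  show "poly_time (\<lambda>z. tdouble (left z) (right z))"
    unfolding tdouble_def
  proof (rule poly_time_foldr[where g = "\<lambda>y acc e. Node Leaf (Node Leaf acc)"])
    show "poly_bound (\<lambda>n. 2 * n + 1)" by (intro poly_bound_intros)
    fix e :: tree and ys :: "tree list"
    show "size (foldr (\<lambda>y acc. Node Leaf (Node Leaf acc)) ys (tif (left e) (unary 1) Leaf)) \<le>
        2 * (size (enc_list (\<lambda>y. y) ys) + size e) + 1"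
      unfolding foldr_double using length_dec_list_le[of "enc_list (\<lambda>y. y) ys"] by simp
  qed (intro poly_time_basic)+
qed

text \<open>Numbers that are not an index of \<open>l\<close> are cut off: on malformed inputs the unary
  representation would be exponentially large.\<close>

definition unary_of_binary :: "tree \<Rightarrow> tree \<Rightarrow> tree" where
  "unary_of_binary l b =
     foldr (\<lambda>y acc. tif (tdrop (tdouble y acc) l) (tdouble y acc) Leaf) (dec_list b) Leaf"

text \<open>All partial values are of the form \<open>n div 2\<close>, \<open>n div 2 div 2\<close>
  and so on, hence below the length of \<open>l\<close>, and the cut-off never acts.\<close>

lemma unary_of_binary_enc_nat [simp]:
  "n < length (dec_list l) \<Longrightarrow> unary_of_binary l (enc_nat n) = unary n"
proof (induction n rule: bits.induct)
  case (1 n)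
  show ?case
  proof (cases "n = 0")
    case True
    then show ?thesis by (simp add: unary_of_binary_def enc_nat_def bits.simps[of 0])
  next
    case False
    with 1 have IH: "unary_of_binary l (enc_nat (n div 2)) = unary (n div 2)" by simp
    have "tdouble (enc_bool (odd n)) (unary (n div 2)) = unary n"
      by (simp add: tdouble_eq)
    then show ?thesis
      using False 1 IH
      by (simp add: unary_of_binary_def enc_nat_def bits.simps[of n] tif_def tdrop_eq_Leaf)
  qed
qed

lemma poly_time_unary_of_binary:
  assumes "poly_time f" "poly_time g"
  shows "poly_time (\<lambda>x. unary_of_binary (f x) (g x))"
proof (rule poly_time_apply2[OF _ assms])
  show "poly_time (\<lambda>z. unary_of_binary (left z) (right z))"
    unfolding unary_of_binary_def
  proof (rule poly_time_foldr[where
        g = "\<lambda>y acc e. tif (tdrop (tdouble y acc) (left e)) (tdouble y acc) Leaf"])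
    show "poly_bound (\<lambda>n. n)" by (intro poly_bound_intros)
    fix e :: tree and ys :: "tree list"
    \<comment> \<open>Whatever the digits are, the cut-off keeps the accumulator at most as long as
      \<open>l\<close>, here \<open>left e\<close>.\<close>
    have "size (foldr (\<lambda>y acc. tif (tdrop (tdouble y acc) (left e)) (tdouble y acc) Leaf) ys Leaf) \<le>
        size (left e)"
      using length_dec_list_le[of "left e"]
      by (induction ys) (auto simp: tif_def tdrop_eq_Leaf tdouble_eq)
    then show "size (foldr (\<lambda>y acc. tif (tdrop (tdouble y acc) (left e)) (tdouble y acc) Leaf) ys Leaf) \<le>
        size (enc_list (\<lambda>y. y) ys) + size e"
      using size_left[of e] by simp
  qed (intro poly_time_basic poly_time_tdrop poly_time_tdouble)+
qed

lemmas poly_time_intros =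
  poly_time_basic poly_time_tdrop poly_time_tnth poly_time_teq poly_time_connectives poly_time_tany
  poly_time_iota poly_time_tproduct poly_time_unary_of_binary


section \<open>Equilibria and deviations\<close>

lemma ownerI:
  assumes "arena A" "i \<in> players A" "v \<in> part A i"
  shows "owner A v = i"
  unfolding owner_def
proof (rule the_equality)
  show "j = i" if "j \<in> players A \<and> v \<in> part A j" for j
    using assms that unfolding arena_def disjoint_family_on_def by blast
qed (use assms in blast)

lemma owner_works:
  assumes "arena A" "v \<in> verts A"
  shows "owner A v \<in> players A" "v \<in> part A (owner A v)"
proof -
  obtain i where "i \<in> players A" "v \<in> part A i" using assms unfolding arena_def by blast
  then show "owner A v \<in> players A" "v \<in> part A (owner A v)" using ownerI[OF assms(1)] by auto
qed

lemma prefix_Suc: "prefix (Suc n) w = prefix n w @ [w n]"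
  by (simp add: subsequence_def)

lemma prefix_eqI: "(\<And>k. k < n \<Longrightarrow> w k = w' k) \<Longrightarrow> prefix n w = prefix n w'"
  by (simp add: subsequence_def)

lemma prefix_eqD: "prefix n w = prefix n w' \<Longrightarrow> k < n \<Longrightarrow> w k = w' k"
  by (simp add: subsequence_def)

lemma history_single: "history A v [v]"
  by (simp add: history_def)

lemma history_snoc:
  "history A v0 (h @ [v, w]) \<longleftrightarrow> history A v0 (h @ [v]) \<and> (v, w) \<in> edges A"
  unfolding history_def by (auto simp: successively_append_iff hd_append)

lemma history_prefix: "play A v0 \<pi> \<Longrightarrow> history A v0 (prefix (Suc n) \<pi>)"
proof (induction n)
  case 0
  then show ?case by (simp add: prefix_Suc play_def history_single)
next
  case (Suc n)
  then show ?case
    using history_snoc[of A v0 "prefix n \<pi>" "\<pi> n" "\<pi> (Suc n)"] by (simp add: prefix_Suc play_def)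
qed

lemma history_append:
  assumes "history A v0 (h @ [v])" "history A v h'"
  shows "history A v0 (h @ h')"
  using assms unfolding history_def by (auto simp: successively_append_iff hd_append)

lemma history_in_verts:
  assumes "arena A" "v0 \<in> verts A" "history A v0 (h @ [v])"
  shows "v \<in> verts A"
proof (cases h rule: rev_cases)
  case Nil
  then show ?thesis using assms by (simp add: history_def)
next
  case (snoc g u)
  then have "(u, v) \<in> edges A" using assms(3) history_snoc[of A v0 g u v] by simp
  then show ?thesis using assms(1) unfolding arena_def by blast
qed

lemma play_conc:
  assumes "history A v0 (h @ [v])" "play A v \<pi>"
  shows "play A v0 (h \<frown> \<pi>)"
proof -
  have "history A v0 (h @ [v]) \<Longrightarrow> play A v \<pi> \<Longrightarrow> play A v0 (h \<frown> \<pi>)"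
  proof (induction h arbitrary: v \<pi> rule: rev_induct)
    case Nil
    then show ?case by (simp add: history_def)
  next
    case (snoc u h)
    have "play A u ([u] \<frown> \<pi>)"
      using snoc.prems history_snoc[of A v0 h u v] unfolding play_def
      by (auto simp: conc_def gr0_conv_Suc)
    moreover have "history A v0 (h @ [u])" using snoc.prems history_snoc[of A v0 h u v] by simp
    ultimately show ?case using snoc.IH by simp
  qed
  with assms show ?thesis by blast
qed

lemma play_in_verts: "arena A \<Longrightarrow> play A v0 \<pi> \<Longrightarrow> \<pi> n \<in> verts A"
  unfolding arena_def play_def by blast

lemma compatible_play_move:
  "compatible_play A v0 \<sigma> \<pi> \<Longrightarrow> \<pi> (Suc n) = profile_move A \<sigma> (prefix (Suc n) \<pi>)"
  unfolding compatible_play_def by blast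

lemma compatible_play_unique:
  assumes "compatible_play A v0 \<sigma> \<pi>" "compatible_play A v0 \<sigma> \<pi>'"
  shows "\<pi> = \<pi>'"
proof -
  have "\<forall>k\<le>n. \<pi> k = \<pi>' k" for n
  proof (induction n)
    case 0
    then show ?case using assms by (simp add: compatible_play_def play_def)
  next
    case (Suc n)
    then have "prefix (Suc n) \<pi> = prefix (Suc n) \<pi>'" by (intro prefix_eqI) simp
    then have "\<pi> (Suc n) = \<pi>' (Suc n)" using assms[THEN compatible_play_move, of n] by (simp only:)
    with Suc show ?case by (auto simp: le_Suc_eq)
  qed
  then show ?thesis by blast
qed

lemma outcome_eqI: "compatible_play A v0 \<sigma> \<pi> \<Longrightarrow> outcome A v0 \<sigma> = \<pi>"
  unfolding outcome_def by (rule the_equality) (auto intro: compatible_play_unique)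

lemma profile_move_edge:
  assumes "arena A" "v0 \<in> verts A" "profile A v0 \<sigma>" "history A v0 (h @ [v])"
  shows "(v, profile_move A \<sigma> (h @ [v])) \<in> edges A"
  using assms owner_works[OF assms(1) history_in_verts[OF assms(1,2,4)]]
  unfolding profile_def strategy_def profile_move_def by simp

text \<open>Existence for the definite description in \<open>outcome\<close>: histories grow by one
  prescribed move at a time, and the play consists of their last vertices.\<close>

lemma compatible_play_outcome:
  assumes "arena A" "v0 \<in> verts A" "profile A v0 \<sigma>"
  shows "compatible_play A v0 \<sigma> (outcome A v0 \<sigma>)"
proof -
  define H where "H = rec_nat [v0] (\<lambda>_ h. h @ [profile_move A \<sigma> h])"
  have H0: "H 0 = [v0]" and HS: "H (Suc n) = H n @ [profile_move A \<sigma> (H n)]" for n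
    by (auto simp: H_def)
  define \<pi> where "\<pi> n = last (H n)" for n
  have H: "H n = prefix (Suc n) \<pi>" for n
  proof (induction n)
    case 0
    then show ?case by (simp add: H0 \<pi>_def prefix_Suc)
  next
    case (Suc n)
    then show ?case using prefix_Suc[of \<pi> "Suc n"] by (simp add: HS \<pi>_def)
  qed
  have step: "\<pi> (Suc n) = profile_move A \<sigma> (H n)" for n by (simp add: \<pi>_def HS)
  have hist: "history A v0 (H n) \<and> (\<pi> n, \<pi> (Suc n)) \<in> edges A" for n
  proof (induction n)
    case 0
    show ?case
      using profile_move_edge[OF assms, of "[]" v0] history_single[of A v0]
      by (simp add: step) (simp add: H0 \<pi>_def)
  next
    case (Suc n)
    then have "history A v0 (H (Suc n))"
      using history_snoc[of A v0 "prefix n \<pi>" "\<pi> n" "\<pi> (Suc n)"] H[of n] H[of "Suc n"]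
      by (simp add: prefix_Suc)
    moreover from this have "(\<pi> (Suc n), \<pi> (Suc (Suc n))) \<in> edges A"
      using profile_move_edge[OF assms, of "prefix (Suc n) \<pi>" "\<pi> (Suc n)"] H[of "Suc n"]
      unfolding step[of "Suc n"] by (simp add: prefix_Suc)
    ultimately show ?case by blast
  qed
  have "\<pi> 0 = v0" by (simp add: H0 \<pi>_def)
  then have "compatible_play A v0 \<sigma> \<pi>"
    unfolding compatible_play_def play_def using hist step[unfolded H] by blast
  then show ?thesis using outcome_eqI by metis
qed

lemma strategy_shift:
  assumes "history A v0 (h @ [v])" "strategy A v0 i s"
  shows "strategy A v i (\<lambda>h'. s (h @ h'))"
  using assms(2) history_append[OF assms(1)] unfolding strategy_def by (metis append_assoc)

lemma profile_shift:
  "history A v0 (h @ [v]) \<Longrightarrow> profile A v0 \<sigma> \<Longrightarrow> profile A v (\<lambda>i h'. \<sigma> i (h @ h'))"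
  unfolding profile_def by (auto intro: strategy_shift)

lemma profile_move_shift:
  "h' \<noteq> [] \<Longrightarrow> profile_move A (\<lambda>i h'. \<sigma> i (h @ h')) h' = profile_move A \<sigma> (h @ h')"
  by (simp add: profile_move_def)

lemma conc_prefix: "prefix (Suc (length h + n)) (h \<frown> \<pi>) = h @ prefix (Suc n) \<pi>"
  by (simp flip: prefix_conc_length)

lemma compatible_playD: "compatible_play A v0 \<sigma> \<pi> \<Longrightarrow> play A v0 \<pi>"
  unfolding compatible_play_def by blast

lemma prefix_Suc_neq_Nil: "prefix (Suc n) w \<noteq> []"
  and last_prefix_Suc: "last (prefix (Suc n) w) = w n"
  by (auto simp: prefix_Suc)

lemma profile_move_update:
  "profile_move A (\<sigma>(i := s)) h = (if owner A (last h) = i then s h else profile_move A \<sigma> h)"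
  by (simp add: profile_move_def)

text \<open>One notion serves both problems: with \<open>sp\<close> false only the whole game may
  fail to be in equilibrium, with \<open>sp\<close> true any subgame may.\<close>

definition violated ::
    "bool \<Rightarrow> ('p, 'v) arena \<Rightarrow> ('p \<Rightarrow> 'v word \<Rightarrow> real) \<Rightarrow> 'v \<Rightarrow> ('p \<Rightarrow> 'v list \<Rightarrow> 'v) \<Rightarrow> bool" where
  "violated sp A \<mu> v0 \<sigma> \<longleftrightarrow>
     (\<exists>h v. (sp \<or> h = []) \<and> history A v0 (h @ [v]) \<and>
        \<not> nash_equilibrium A (\<lambda>i \<pi>. \<mu> i (h \<frown> \<pi>)) v (\<lambda>i h'. \<sigma> i (h @ h')))"

text \<open>\<open>d\<close> is the point at which player \<open>i\<close> deviates, turning the outcome \<open>\<alpha>\<close> into \<open>\<beta>\<close>. In the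
  subgame-perfect case the history leading to that point is arbitrary.\<close>

definition deviation ::
    "bool \<Rightarrow> ('p, 'v) arena \<Rightarrow> 'v \<Rightarrow> ('q, 'v) mealy \<Rightarrow> 'p \<Rightarrow> 'v word \<Rightarrow> 'v word \<Rightarrow> bool" where
  "deviation sp A v0 M i \<alpha> \<beta> \<longleftrightarrow> play A v0 \<alpha> \<and> play A v0 \<beta> \<and>
     (\<exists>d \<rho> \<rho>'. \<rho> 0 = start M \<and> (\<forall>n\<le>d. \<alpha> n = \<beta> n) \<and> \<alpha> (Suc d) \<noteq> \<beta> (Suc d) \<and>
        (\<forall>n\<le>Suc d. \<rho>' n = \<rho> n) \<and> \<beta> d \<in> part A i \<and>
        (\<forall>n. \<exists>x. (\<rho> n, \<alpha> n, \<rho> (Suc n), x) \<in> delta M \<and> (sp \<and> n < d \<or> x = \<alpha> (Suc n))) \<and>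
        (\<forall>n>d. \<exists>x. (\<rho>' n, \<beta> n, \<rho>' (Suc n), x) \<in> delta M \<and> (\<beta> n \<in> part A i \<or> x = \<beta> (Suc n))))"

text \<open>Both outcomes of the failing subgame are prolonged by its history \<open>h\<close> and
  read along one state map of the machine. The separation point \<open>d\<close> may lie well inside
  the subgame; whatever precedes it counts as common history.\<close>

lemma deviation_if_violated:
  assumes A: "arena A" "v0 \<in> verts A" and \<sigma>: "\<sigma> \<in> Comp A v0 M" "violated sp A \<mu> v0 \<sigma>"
  shows "\<exists>i\<in>players A. \<exists>\<alpha> \<beta>. deviation sp A v0 M i \<alpha> \<beta> \<and> \<mu> i \<alpha> < \<mu> i \<beta>"
proof -
  obtain r where r: "r [] = start M"
      "\<And>h v. history A v0 (h @ [v]) \<Longrightarrow> (r h, v, r (h @ [v]), profile_move A \<sigma> (h @ [v])) \<in> delta M"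
    and prof: "profile A v0 \<sigma>"
    using \<sigma>(1) unfolding Comp_def by blast
  obtain h v where h: "sp \<or> h = []" "history A v0 (h @ [v])"
      "\<not> nash_equilibrium A (\<lambda>i \<pi>. \<mu> i (h \<frown> \<pi>)) v (\<lambda>i h'. \<sigma> i (h @ h'))"
    using \<sigma>(2) unfolding violated_def by blast
  let ?\<sigma> = "\<lambda>i h'. \<sigma> i (h @ h')"
  have prof': "profile A v ?\<sigma>" by (rule profile_shift[OF h(2) prof])
  then obtain i s where i: "i \<in> players A" and s: "strategy A v i s" and
      less: "\<mu> i (h \<frown> outcome A v ?\<sigma>) < \<mu> i (h \<frown> outcome A v (?\<sigma>(i := s)))"
    using h(3) unfolding nash_equilibrium_def by force
  have v: "v \<in> verts A" by (rule history_in_verts[OF A h(2)])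
  define \<alpha>0 \<beta>0 where ab0: "\<alpha>0 = outcome A v ?\<sigma>" "\<beta>0 = outcome A v (?\<sigma>(i := s))"
  define \<alpha> \<beta> where ab: "\<alpha> = h \<frown> \<alpha>0" "\<beta> = h \<frown> \<beta>0"
  have a0: "compatible_play A v ?\<sigma> \<alpha>0"
    unfolding ab0 by (rule compatible_play_outcome[OF A(1) v prof'])
  have b0: "compatible_play A v (?\<sigma>(i := s)) \<beta>0"
    unfolding ab0 by (rule compatible_play_outcome[OF A(1) v])
      (use prof' s in \<open>simp add: profile_def\<close>)
  have play: "play A v0 \<alpha>" "play A v0 \<beta>"
    unfolding ab
    by (rule play_conc[OF h(2) compatible_playD[OF a0]],
        rule play_conc[OF h(2) compatible_playD[OF b0]])
  have shift: "profile_move A ?\<sigma> (prefix (Suc m) w) = profile_move A \<sigma> (h @ prefix (Suc m) w)" for m w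
    by (rule profile_move_shift[OF prefix_Suc_neq_Nil])
  have a_move: "\<alpha> (Suc n) = profile_move A \<sigma> (prefix (Suc n) \<alpha>)" if le: "length h \<le> n" for n
  proof -
    obtain m where n: "n = length h + m" using le_Suc_ex[OF le] ..
    have "\<alpha>0 (Suc m) = profile_move A \<sigma> (h @ prefix (Suc m) \<alpha>0)"
      by (rule compatible_play_move[OF a0, of m, unfolded shift])
    moreover have "\<alpha> (Suc n) = \<alpha>0 (Suc m)" by (simp add: n ab conc_def)
    moreover have "prefix (Suc n) \<alpha> = h @ prefix (Suc m) \<alpha>0" unfolding n ab by (rule conc_prefix)
    ultimately show ?thesis by metis
  qed
  have b_move: "\<beta> n \<in> part A i \<or> \<beta> (Suc n) = profile_move A \<sigma> (prefix (Suc n) \<beta>)"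
    if le: "length h \<le> n" for n
  proof -
    obtain m where n: "n = length h + m" using le_Suc_ex[OF le] ..
    have \<beta>0: "\<beta> n = \<beta>0 m" by (simp add: n ab conc_def)
    have "\<beta>0 (Suc m) = profile_move A \<sigma> (h @ prefix (Suc m) \<beta>0)" if "owner A (\<beta>0 m) \<noteq> i"
      using compatible_play_move[OF b0, of m] that
      by (simp only: profile_move_update last_prefix_Suc shift if_False)
    moreover have "\<beta> (Suc n) = \<beta>0 (Suc m)" by (simp add: n ab conc_def)
    moreover have "prefix (Suc n) \<beta> = h @ prefix (Suc m) \<beta>0" unfolding n ab by (rule conc_prefix)
    ultimately have "owner A (\<beta> n) = i \<or> \<beta> (Suc n) = profile_move A \<sigma> (prefix (Suc n) \<beta>)"
      unfolding \<beta>0 by metis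
    then show ?thesis using owner_works(2)[OF A(1) play_in_verts[OF A(1) play(2)]] by metis
  qed
  have "\<alpha> \<noteq> \<beta>" using less ab ab0 by auto
  then have ex: "\<exists>n. \<alpha> n \<noteq> \<beta> n" by blast
  define N where "N = (LEAST n. \<alpha> n \<noteq> \<beta> n)"
  have N: "\<alpha> N \<noteq> \<beta> N" unfolding N_def using ex by (rule LeastI_ex)
  have below: "\<alpha> n = \<beta> n" if "n < N" for n using that not_less_Least unfolding N_def by blast
  \<comment> \<open>Both plays run through \<open>h\<close> and then visit \<open>v\<close>, so they
    differ only after position \<open>length h\<close>.\<close>
  have "\<alpha> n = \<beta> n" if "n \<le> length h" for n
    using that a0[THEN compatible_playD] b0[THEN compatible_playD]
    unfolding ab play_def by (auto simp: conc_def)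
  then have "length h < N" using N not_le by blast
  then obtain d where d: "N = Suc d" "length h \<le> d" by (cases N) auto
  have pre: "prefix n \<beta> = prefix n \<alpha>" if "n \<le> Suc d" for n
    using below that by (intro prefix_eqI) (auto simp: d)
  have trans: "(r (prefix n \<pi>), \<pi> n, r (prefix (Suc n) \<pi>), profile_move A \<sigma> (prefix (Suc n) \<pi>)) \<in> delta M"
    if "play A v0 \<pi>" for n \<pi>
    using r(2)[of "prefix n \<pi>" "\<pi> n"] history_prefix[OF that, of n] by (simp add: prefix_Suc)
  have "deviation sp A v0 M i \<alpha> \<beta>"
    unfolding deviation_def
  proof (rule conjI, fact play(1), rule conjI, fact play(2), rule exI[of _ d],
      rule exI[of _ "\<lambda>n. r (prefix n \<alpha>)"], rule exI[of _ "\<lambda>n. r (prefix n \<beta>)"],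
      intro conjI allI impI)
    show "r (prefix 0 \<alpha>) = start M" by (simp add: r)
    show "\<alpha> n = \<beta> n" if "n \<le> d" for n using below that d by simp
    show "\<alpha> (Suc d) \<noteq> \<beta> (Suc d)" using N d by simp
    show "r (prefix n \<beta>) = r (prefix n \<alpha>)" if "n \<le> Suc d" for n using pre[OF that] by simp
    \<comment> \<open>On the common prefix the profile prescribes the move of
      \<open>\<alpha>\<close>, so the different move of \<open>\<beta>\<close> must be made by
      \<open>i\<close>.\<close>
    show "\<beta> d \<in> part A i"
      using b_move[OF d(2)] a_move[OF d(2)] N pre[of "Suc d"] d(1) by auto
    \<comment> \<open>Inside \<open>h\<close> the play may ignore the profile; but then
      \<open>h\<close> is nonempty, which forces \<open>sp\<close>, and
      \<open>n < length h \<le> d\<close>.\<close>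
    show "\<exists>x. (r (prefix n \<alpha>), \<alpha> n, r (prefix (Suc n) \<alpha>), x) \<in> delta M \<and>
        (sp \<and> n < d \<or> x = \<alpha> (Suc n))" for n
      using trans[OF play(1), of n] a_move[of n] h(1) d(2) by (cases "length h \<le> n") auto
    show "\<exists>x. (r (prefix n \<beta>), \<beta> n, r (prefix (Suc n) \<beta>), x) \<in> delta M \<and>
        (\<beta> n \<in> part A i \<or> x = \<beta> (Suc n))" if "d < n" for n
      using trans[OF play(2), of n] b_move[of n] d(2) that by auto
  qed
  then show ?thesis using i less ab ab0 by blast
qed

text \<open>The profile is glued from three sources: the run \<open>r\<close> on prefixes of
  \<open>\<alpha>\<close>, the run \<open>r'\<close> on prefixes of \<open>\<beta>\<close>, and
  fixed transitions \<open>Q\<close>, \<open>W\<close> of the machine elsewhere. They do not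
  conflict, since the runs agree on shared prefixes and longer prefixes of the two plays
  differ.\<close>

lemma violated_if_deviation:
  assumes A: "arena A" "v0 \<in> verts A" and M: "mealy_machine A M" and i: "i \<in> players A"
    and dev: "deviation sp A v0 M i \<alpha> \<beta>" and less: "\<mu> i \<alpha> < \<mu> i \<beta>"
  shows "\<exists>\<sigma>\<in>Comp A v0 M. violated sp A \<mu> v0 \<sigma>"
proof -
  obtain d r r' where play: "play A v0 \<alpha>" "play A v0 \<beta>" and r: "r 0 = start M"
    and below: "\<And>n. n \<le> d \<Longrightarrow> \<alpha> n = \<beta> n" and split: "\<alpha> (Suc d) \<noteq> \<beta> (Suc d)"
    and r': "\<And>n. n \<le> Suc d \<Longrightarrow> r' n = r n" and d: "\<beta> d \<in> part A i"
    and ta: "\<And>n. \<exists>x. (r n, \<alpha> n, r (Suc n), x) \<in> delta M \<and> (sp \<and> n < d \<or> x = \<alpha> (Suc n))"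
    and tb: "\<And>n. n > d \<Longrightarrow> \<exists>x. (r' n, \<beta> n, r' (Suc n), x) \<in> delta M \<and> (\<beta> n \<in> part A i \<or> x = \<beta> (Suc n))"
    using dev unfolding deviation_def by blast
  obtain X where X: "\<And>n. (r n, \<alpha> n, r (Suc n), X n) \<in> delta M" "\<And>n. sp \<and> n < d \<or> X n = \<alpha> (Suc n)"
    using ta by metis
  obtain Y where Y: "\<And>n. n > d \<Longrightarrow> (r' n, \<beta> n, r' (Suc n), Y n) \<in> delta M"
      "\<And>n. n > d \<Longrightarrow> \<beta> n \<in> part A i \<or> Y n = \<beta> (Suc n)"
    using tb by metis
  have "\<forall>p u. \<exists>q w. p \<in> states M \<longrightarrow> u \<in> verts A \<longrightarrow> (p, u, q, w) \<in> delta M"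
    using M unfolding mealy_machine_def by blast
  then obtain Q W where QW: "\<And>p u. p \<in> states M \<Longrightarrow> u \<in> verts A \<Longrightarrow> (p, u, Q p u, W p u) \<in> delta M"
    by metis
  have deltaD: "p \<in> states M \<and> q \<in> states M \<and> (u, w) \<in> edges A" if "(p, u, q, w) \<in> delta M" for p u q w
    using M that unfolding mealy_machine_def by blast
  have neq: "prefix (Suc n) \<beta> \<noteq> prefix (Suc n) \<alpha>" if "n > d" for n
    using prefix_eqD[of \<beta> "Suc n" \<alpha> "Suc d"] split that by auto
  have eq: "prefix n \<beta> = prefix n \<alpha>" if "n \<le> Suc d" for n
    using below that by (intro prefix_eqI) auto
  \<comment> \<open>The state after a history depends on the state before its last vertex, so the
    recursion runs over the reversed history; \<open>rev h' @ [v]\<close> is what has been read so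
    far.\<close>
  define R where "R h = rec_list (start M) (\<lambda>v h' p.
      if rev h' @ [v] = prefix (Suc (length h')) \<alpha> then r (Suc (length h'))
      else if rev h' @ [v] = prefix (Suc (length h')) \<beta> then r' (Suc (length h'))
      else Q p v) (rev h)" for h
  have R_Nil: "R [] = start M" by (simp add: R_def)
  have R_snoc: "R (h @ [v]) =
      (if h @ [v] = prefix (Suc (length h)) \<alpha> then r (Suc (length h))
       else if h @ [v] = prefix (Suc (length h)) \<beta> then r' (Suc (length h))
       else Q (R h) v)" for h v
    by (simp add: R_def)
  define mv where "mv h = (let n = length h - 1 in
      if h = prefix (Suc n) \<alpha> then X n else if h = prefix (Suc n) \<beta> then Y n
      else W (R (butlast h)) (last h))" for h
  have Ra: "R (prefix n \<alpha>) = r n" for n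
    by (cases n) (auto simp: R_Nil r prefix_Suc R_snoc)
  have Rb: "R (prefix n \<beta>) = r' n" for n
  proof (cases "n \<le> Suc d")
    case True
    then show ?thesis using eq Ra r' by simp
  next
    case False
    then obtain m where m: "n = Suc m" "m > d" by (cases n) auto
    show ?thesis
      using neq[OF m(2)] R_snoc[of "prefix m \<beta>" "\<beta> m"] unfolding m(1) prefix_Suc[symmetric] by auto
  qed
  have mv_a: "mv (prefix (Suc n) \<alpha>) = X n" for n by (simp add: mv_def)
  have mv_b: "mv (prefix (Suc n) \<beta>) = Y n" if "n > d" for n using neq[OF that] by (auto simp: mv_def)
  have step: "(R h, v, R (h @ [v]), mv (h @ [v])) \<in> delta M"
    if hist: "history A v0 (h @ [v])" and st: "R h \<in> states M" for h v
  proof -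
    let ?n = "length h"
    \<comment> \<open>Prefixes of \<open>\<beta>\<close> of length at most \<open>Suc d\<close> are
      prefixes of \<open>\<alpha>\<close> too; this gives the extra condition in case
      \<open>b\<close>.\<close>
    consider (a) "h @ [v] = prefix (Suc ?n) \<alpha>" | (b) "h @ [v] = prefix (Suc ?n) \<beta>" "?n > d"
      | (c) "h @ [v] \<noteq> prefix (Suc ?n) \<alpha>" "h @ [v] \<noteq> prefix (Suc ?n) \<beta>"
      using eq[of "Suc ?n"] by force
    then show ?thesis
    proof cases
      case a
      then have "h = prefix ?n \<alpha>" "v = \<alpha> ?n" by (auto simp: prefix_Suc)
      then show ?thesis using X(1)[of ?n] Ra mv_a a by metis
    next
      case b
      then have "h = prefix ?n \<beta>" "v = \<beta> ?n" by (auto simp: prefix_Suc)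
      then show ?thesis using Y(1)[OF b(2)] Rb mv_b[OF b(2)] b(1) by metis
    next
      case c
      then have "R (h @ [v]) = Q (R h) v" "mv (h @ [v]) = W (R h) v"
        by (auto simp: R_snoc mv_def)
      then show ?thesis using QW[OF st history_in_verts[OF A hist]] by simp
    qed
  qed
  have st: "history A v0 h \<Longrightarrow> R h \<in> states M" for h
  proof (induction h rule: rev_induct)
    case Nil
    then show ?case by (simp add: history_def)
  next
    case (snoc v h)
    have "R h \<in> states M"
    proof (cases h rule: rev_cases)
      case Nil
      then show ?thesis using R_Nil M unfolding mealy_machine_def by simp
    next
      case (snoc h' u)
      then have "history A v0 h" using \<open>history A v0 (h @ [v])\<close> history_snoc[of A v0 h' u v] by simp
      then show ?thesis by (rule snoc.IH)
    qed
    from deltaD[OF step[OF snoc.prems this]] show ?case by blast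
  qed
  have st': "R h \<in> states M" if "history A v0 (h @ [v])" for h v
  proof (cases h rule: rev_cases)
    case Nil
    then show ?thesis using R_Nil M unfolding mealy_machine_def by simp
  next
    case (snoc h' u)
    then show ?thesis using that history_snoc[of A v0 h' u v] by (auto intro: st)
  qed
  note step' = step[OF _ st']
  \<comment> \<open>All players share one move function; at each history only the owner of the last
    vertex consults it.\<close>
  define \<sigma> where "\<sigma> = (\<lambda>_::'a. mv)"
  have pm: "profile_move A \<sigma> = mv" by (simp add: fun_eq_iff profile_move_def \<sigma>_def)
  have prof: "profile A v0 \<sigma>"
    unfolding profile_def strategy_def \<sigma>_def using deltaD[OF step'] by blast
  have "\<sigma> \<in> Comp A v0 M"
    unfolding Comp_def mem_Collect_eq pm using prof R_Nil st step' by blast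
  moreover have "violated sp A \<mu> v0 \<sigma>"
  proof -
    \<comment> \<open>With \<open>sp\<close>, moves of \<open>\<alpha>\<close> before
      \<open>d\<close> may differ from the prescribed ones, so the subgame starts at
      \<open>d\<close>. Without \<open>sp\<close> all moves of \<open>\<alpha>\<close> are
      prescribed and the whole game serves.\<close>
    define e where "e = (if sp then d else 0)"
    define h v where hv: "h = prefix e \<alpha>" "v = \<alpha> e"
    have len: "length h = e" by (simp add: hv)
    have hist: "history A v0 (h @ [v])" using history_prefix[OF play(1), of e] by (simp add: hv prefix_Suc)
    have hb: "h = prefix e \<beta>" unfolding hv by (rule eq[symmetric]) (simp add: e_def)
    have vb: "v = \<beta> e" unfolding hv by (rule below) (simp add: e_def)
    let ?\<sigma> = "\<lambda>i h'. \<sigma> i (h @ h')"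
    \<comment> \<open>Off the prefixes of \<open>\<beta>\<close> the deviating strategy copies
      \<open>mv\<close>, so as to be legal on every history.\<close>
    define s where "s h' = (let H = h @ h' in if H = prefix (length H) \<beta> then \<beta> (length H) else mv H)" for h'
    have conc_a: "h \<frown> suffix e \<alpha> = \<alpha>" unfolding hv by (rule prefix_suffix[symmetric])
    have conc_b: "h \<frown> suffix e \<beta> = \<beta>" unfolding hb by (rule prefix_suffix[symmetric])
    have pre_a: "h @ prefix (Suc n) (suffix e \<alpha>) = prefix (Suc (e + n)) \<alpha>" for n
      using conc_prefix[of h "suffix e \<alpha>" n] unfolding conc_a len by simp
    have pre_b: "h @ prefix (Suc n) (suffix e \<beta>) = prefix (Suc (e + n)) \<beta>" for n
      using conc_prefix[of h "suffix e \<beta>" n] unfolding conc_b len by simp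
    have pa: "play A v (suffix e \<alpha>)" using play(1) by (simp add: play_def hv)
    have pb: "play A v (suffix e \<beta>)" using play(2) by (simp add: play_def vb)
    have Xe: "X (e + n) = \<alpha> (Suc (e + n))" for n using X(2)[of "e + n"] by (auto simp: e_def)
    have "profile_move A ?\<sigma> (prefix (Suc n) (suffix e \<alpha>)) = \<alpha> (Suc (e + n))" for n
      unfolding profile_move_shift[OF prefix_Suc_neq_Nil, where \<sigma> = \<sigma> and h = h] pm pre_a mv_a Xe ..
    then have "compatible_play A v ?\<sigma> (suffix e \<alpha>)"
      unfolding compatible_play_def using pa by (simp only: suffix_nth add_Suc_right simp_thms)
    from outcome_eqI[OF this] have oa: "h \<frown> outcome A v ?\<sigma> = \<alpha>" by (simp add: conc_a)
    have strat: "strategy A v i s"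
      unfolding strategy_def
    proof (intro allI impI, elim conjE)
      fix h' u assume h': "history A v (h' @ [u])"
      then have hist': "history A v0 ((h @ h') @ [u])" using history_append[OF hist] by simp
      show "(u, s (h' @ [u])) \<in> edges A"
      proof (cases "(h @ h') @ [u] = prefix (length ((h @ h') @ [u])) \<beta>")
        case True
        then have u: "u = \<beta> (length (h @ h'))" by (simp add: prefix_Suc)
        have "s (h' @ [u]) = \<beta> (length ((h @ h') @ [u]))" unfolding s_def Let_def using True by simp
        then show ?thesis using play(2) u by (simp add: play_def)
      next
        case False
        then have "s (h' @ [u]) = mv ((h @ h') @ [u])" unfolding s_def Let_def by auto
        then show ?thesis using deltaD[OF step'[OF hist' hist']] by simp
      qed
    qed
    have "profile_move A (?\<sigma>(i := s)) (prefix (Suc n) (suffix e \<beta>)) = \<beta> (Suc (e + n))" for n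
    proof (cases "\<beta> (e + n) \<in> part A i")
      case True
      then have "owner A (\<beta> (e + n)) = i" by (rule ownerI[OF A(1) i])
      moreover have "s (prefix (Suc n) (suffix e \<beta>)) = \<beta> (Suc (e + n))"
        unfolding s_def pre_b by simp
      ultimately show ?thesis by (simp add: profile_move_def prefix_Suc)
    next
      case False
      then have "owner A (\<beta> (e + n)) \<noteq> i"
        using owner_works(2)[OF A(1) play_in_verts[OF A(1) play(2), of "e + n"]] by metis
      then have "profile_move A (?\<sigma>(i := s)) (prefix (Suc n) (suffix e \<beta>)) = mv (prefix (Suc (e + n)) \<beta>)"
        unfolding profile_move_update last_prefix_Suc suffix_nth
          profile_move_shift[OF prefix_Suc_neq_Nil, where \<sigma> = \<sigma> and h = h] pm pre_b
        by (rule if_not_P)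
      also have "\<dots> = \<beta> (Suc (e + n))"
      proof -
        \<comment> \<open>Before \<open>d\<close> the prescribed move is shared with
          \<open>\<alpha>\<close>, at \<open>d\<close> the vertex belongs to \<open>i\<close>, and
          after \<open>d\<close> the move is prescribed by \<open>Y\<close>.\<close>
        consider "e + n < d" | "e + n = d" | "e + n > d" by linarith
        then show ?thesis
        proof cases
          case 1
          then show ?thesis using eq[of "Suc (e + n)"] mv_a Xe below[of "Suc (e + n)"] by simp
        next
          case 2
          then show ?thesis using d False by simp
        next
          case 3
          then show ?thesis using mv_b[OF 3] Y(2)[OF 3] False by simp
        qed
      qed
      finally show ?thesis .
    qed
    then have "compatible_play A v (?\<sigma>(i := s)) (suffix e \<beta>)"
      unfolding compatible_play_def using pb by (simp only: suffix_nth add_Suc_right simp_thms)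
    from outcome_eqI[OF this] have ob: "h \<frown> outcome A v (?\<sigma>(i := s)) = \<beta>" by (simp add: conc_b)
    have "\<not> nash_equilibrium A (\<lambda>i \<pi>. \<mu> i (h \<frown> \<pi>)) v ?\<sigma>"
      unfolding nash_equilibrium_def using i strat less oa ob by (metis not_le)
    moreover have "sp \<or> h = []" by (simp add: hv e_def)
    ultimately show ?thesis
      unfolding violated_def using hist by (intro exI[of _ h] exI[of _ v] conjI)
  qed
  ultimately show ?thesis by blast
qed


section \<open>The pair game\<close>

type_synonym cell = "nat \<times> nat \<times> nat \<times> nat \<times> nat \<times> nat"

text \<open>In a cell \<open>(b, i, p, u, p', u')\<close>, player \<open>i\<close> is the one who may deviate, \<open>(p, u)\<close> follows the
  outcome and \<open>(p', u')\<close> the deviation. The mode \<open>b\<close> is 0 before the choice of \<open>i\<close>, 1 as long as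
  the two plays agree, and 2 afterwards.\<close>

fun mode :: "cell \<Rightarrow> nat" where "mode (b, i, p, u, p', u') = b"
fun deviator :: "cell \<Rightarrow> nat" where "deviator (b, i, p, u, p', u') = i"
fun side :: "nat \<Rightarrow> cell \<Rightarrow> nat" where "side a (b, i, p, u, p', u') = (if a = 0 then u else u')"

definition cells :: "nat \<Rightarrow> nat \<Rightarrow> nat \<Rightarrow> cell list" where
  "cells k m n = List.product [0..<3] (List.product [0..<k] (List.product [0..<m]
     (List.product [0..<n] (List.product [0..<m] [0..<n]))))"

text \<open>With \<open>sp\<close>, a step in mode 1 must respect the state update of the machine
  but not its proposed move, which yields arbitrary histories. Entering mode 2 still reads the last
  common vertex, hence \<open>q' = q\<close> although \<open>w' \<noteq> w\<close>. The quantifiers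
  over \<open>x\<close> are bounded by \<open>verts A\<close> to become tests on finite
  tables.\<close>

fun cell_step ::
    "bool \<Rightarrow> (nat, nat) arena \<Rightarrow> nat \<Rightarrow> (nat, nat) mealy \<Rightarrow> cell \<Rightarrow> cell \<Rightarrow> bool" where
  "cell_step sp A v0 M (b, i, p, u, p', u') (c, j, q, w, q', w') \<longleftrightarrow>
     b = 0 \<and> c = 1 \<and> q = start M \<and> q' = start M \<and> w = v0 \<and> w' = v0 \<or>
     b \<noteq> 0 \<and> j = i \<and>
      (b = 1 \<and> q' = q \<and>
        (c = 1 \<and> w' = w \<and> (u, w) \<in> edges A \<and>
           (if sp then \<exists>x\<in>verts A. (p, u, q, x) \<in> delta M else (p, u, q, w) \<in> delta M) \<or>
         c = 2 \<and> w' \<noteq> w \<and> (p, u, q, w) \<in> delta M \<and> u \<in> part A i \<and> (u, w') \<in> edges A) \<or>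
       b = 2 \<and> c = 2 \<and> (p, u, q, w) \<in> delta M \<and>
         ((p', u', q', w') \<in> delta M \<or>
          u' \<in> part A i \<and> (u', w') \<in> edges A \<and> (\<exists>x\<in>verts A. (p', u', q', x) \<in> delta M)))"

definition arena_cells :: "(nat, nat) arena \<Rightarrow> (nat, nat) mealy \<Rightarrow> cell list" where
  "arena_cells A M = cells (card (players A)) (card (states M)) (card (verts A))"

text \<open>Positions in the list of cells serve as vertices because inputs require an initial
  segment of the naturals. Position 0 is the cell of zeros, which has mode 0 and is the initial
  vertex.\<close>

definition pair_arena :: "bool \<Rightarrow> (nat, nat) arena \<Rightarrow> nat \<Rightarrow> (nat, nat) mealy \<Rightarrow> (nat, nat) arena" where
  "pair_arena sp A v0 M = (let L = arena_cells A M in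
     \<lparr> players = {0, 1}, verts = {..<length L}, part = (\<lambda>i. if i = 0 then {..<length L} else {}),
       edges = {(x, y). x < length L \<and> y < length L \<and> cell_step sp A v0 M (L ! x) (L ! y)} \<rparr>)"

text \<open>The opening move is worth 0. The edge test mirrors the zeros that the encoding stores
  off the edges: unreachable cells of mode 1 with \<open>u \<noteq> u'\<close> allow the second side
  to jump along a non-edge.\<close>

definition pair_rewards ::
    "(nat, nat) arena \<Rightarrow> cell list \<Rightarrow> (nat \<Rightarrow> nat \<times> nat \<Rightarrow> rat) \<Rightarrow> nat \<Rightarrow> nat \<times> nat \<Rightarrow> rat" where
  "pair_rewards A L r a = (\<lambda>(x, y).
     if mode (L ! x) \<noteq> 0 \<and> (side a (L ! x), side a (L ! y)) \<in> edges A
     then r (deviator (L ! x)) (side a (L ! x), side a (L ! y)) else 0)"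

text \<open>The vertex components of the initial cell are dummies that could lie in a target, so the
  mode is tested. Colours need no such test, as a single visit does not influence the limit.\<close>

fun pair_objective :: "(nat, nat) arena \<Rightarrow> cell list \<Rightarrow> (nat, nat) objective \<Rightarrow> (nat, nat) objective" where
  "pair_objective A L (Parity \<kappa>) = Parity (\<lambda>a x. \<kappa> (deviator (L ! x)) (side a (L ! x)))"
| "pair_objective A L (Mean_Payoff r) = Mean_Payoff (pair_rewards A L r)"
| "pair_objective A L (Quantitative_Reachability T) = Quantitative_Reachability
     (\<lambda>a. {x. x < length L \<and> mode (L ! x) \<noteq> 0 \<and> side a (L ! x) \<in> T (deviator (L ! x))})"
| "pair_objective A L (Energy r) = Energy (pair_rewards A L r)"
| "pair_objective A L (Discounted_Sum lam r) = Discounted_Sum lam (pair_rewards A L r)"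


text \<open>The effect on the payoffs of the additional first step.\<close>

fun delayed :: "('p, 'v) objective \<Rightarrow> real \<Rightarrow> real" where
  "delayed (Quantitative_Reachability T) x = x / (1 + x)"
| "delayed (Discounted_Sum lam r) x = real_of_rat lam * x"
| "delayed _ x = x"

text \<open>If \<open>x = 1 / (1 + t)\<close>, then \<open>x / (1 + x)\<close> is the value for
  arrival at \<open>t + 1\<close>; this map is strictly increasing on nonnegative reals and fixes 0,
  the value of never arriving. For discounted sums the factor is positive.\<close>

lemma delayed_less:
  assumes "objective_on A obj"
  shows "delayed obj (payoff obj i \<alpha>) < delayed obj (payoff obj i \<beta>) \<longleftrightarrow> payoff obj i \<alpha> < payoff obj i \<beta>"
proof (cases obj)
  case (Quantitative_Reachability T)
  have "x / (1 + x) < y / (1 + y) \<longleftrightarrow> x < y" if "x \<ge> 0" "y \<ge> 0" for x y :: real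
  proof -
    have "x / (1 + x) < y / (1 + y) \<longleftrightarrow> x * (1 + y) < y * (1 + x)"
      using that by (subst divide_less_eq, subst (2) mult.commute) (simp add: less_divide_eq mult.commute)
    then show ?thesis by (simp add: algebra_simps)
  qed
  moreover have "payoff obj i w \<ge> 0" for w by (simp add: Quantitative_Reachability)
  ultimately show ?thesis by (simp only: Quantitative_Reachability delayed.simps)
next
  case (Discounted_Sum lam r)
  then show ?thesis using assms by simp
qed auto

section \<open>Payoffs along a play with an extra opening move\<close>

lemma limit_map:
  assumes "finite (range w)"
  shows "limit (f \<circ> w) = f ` limit w"
proof
  show "f ` limit w \<subseteq> limit (f \<circ> w)" by (rule image_subsetI) (rule limit_o)
  show "limit (f \<circ> w) \<subseteq> f ` limit w"
  proof
    fix y assume y: "y \<in> limit (f \<circ> w)"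
    have "infinite ((f \<circ> w) -` {y})" using y by (simp add: limit_vimage)
    \<comment> \<open>Pigeonhole: only finitely many letters map to \<open>y\<close>, so one of them
      occurs infinitely often.\<close>
    moreover have "(f \<circ> w) -` {y} = (\<Union>x\<in>range w \<inter> f -` {y}. w -` {x})" by auto
    ultimately obtain x where "f x = y" "infinite (w -` {x})"
      using assms finite_UN_I[of "range w \<inter> f -` {y}" "\<lambda>x. w -` {x}"] by auto
    then show "y \<in> f ` limit w" by (auto simp: limit_vimage)
  qed
qed

text \<open>Rewards on the finitely many edges are bounded, so a geometric series dominates.
  Splitting off the opening move and extracting the discount factor both rely on this.\<close>

lemma summable_discounted:
  assumes "arena A" "play A v w" "0 < lam" "lam < 1"
  shows "summable (\<lambda>k. real_of_rat lam ^ k * real_of_rat (r (w k, w (Suc k))))"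
proof -
  let ?f = "\<lambda>e. \<bar>real_of_rat (r e)\<bar>"
  have fin: "finite (edges A)"
    using assms(1) unfolding arena_def by (meson finite_SigmaI finite_subset)
  define B where "B = Max (?f ` edges A)"
  have B: "?f (w k, w (Suc k)) \<le> B" for k
    unfolding B_def using fin assms(2) by (intro Max_ge) (auto simp: play_def)
  have "summable (\<lambda>k. real_of_rat lam ^ k * B)"
    using assms(3,4) by (intro summable_mult2 summable_geometric) simp
  then show ?thesis
  proof (rule summable_comparison_test'[where N = 0])
    fix k
    show "norm (real_of_rat lam ^ k * real_of_rat (r (w k, w (Suc k)))) \<le> real_of_rat lam ^ k * B"
      using B[of k] assms(3) by (simp add: abs_mult mult_left_mono)
  qed
qed

lemma Least_Suc_delayed:
  fixes P Q :: "nat \<Rightarrow> bool"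
  assumes "\<not> P 0" "\<And>n. P (Suc n) \<longleftrightarrow> Q n"
  shows "(\<exists>n. P n) \<longleftrightarrow> (\<exists>n. Q n)" "\<exists>n. Q n \<Longrightarrow> (LEAST n. P n) = Suc (LEAST n. Q n)"
proof -
  show "(\<exists>n. P n) \<longleftrightarrow> (\<exists>n. Q n)" using assms by (metis not0_implies_Suc)
  assume "\<exists>n. Q n"
  then obtain n where "P (Suc n)" using assms(2) by blast
  from Least_Suc[of P, OF this assms(1)] show "(LEAST n. P n) = Suc (LEAST n. Q n)"
    by (simp add: assms(2))
qed

text \<open>The new average over \<open>n + 1\<close> terms is \<open>n / (n + 1)\<close> times the
  old one over \<open>n\<close> terms, and this factor tends to 1. The identity also holds at
  \<open>n = 0\<close>, where division by zero yields 0.\<close>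

lemma liminf_delayed_average:
  fixes f g :: "nat \<Rightarrow> real"
  assumes "f 0 = 0" "\<And>k. f (Suc k) = g k"
  shows "liminf (\<lambda>n. ereal ((\<Sum>k<n. f k) / real n)) = liminf (\<lambda>n. ereal ((\<Sum>k<n. g k) / real n))"
proof -
  have f: "(\<Sum>k<Suc n. f k) = (\<Sum>k<n. g k)" for n
    unfolding sum.lessThan_Suc_shift using assms by simp
  have "liminf (\<lambda>n. ereal ((\<Sum>k<n. f k) / real n)) =
      liminf (\<lambda>n. ereal ((\<Sum>k<Suc n. f k) / real (Suc n)))"
    using liminf_shift[of "\<lambda>n. ereal ((\<Sum>k<n. f k) / real n)"] by simp
  also have "\<dots> = liminf (\<lambda>n. ereal (real n / real (Suc n)) * ereal ((\<Sum>k<n. g k) / real n))"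
    unfolding f by (intro arg_cong[where f = liminf] ext) auto
  also have "\<dots> = 1 * liminf (\<lambda>n. ereal ((\<Sum>k<n. g k) / real n))"
  proof (rule ereal_liminf_lim_mult)
    show "(\<lambda>n. ereal (real n / real (Suc n))) \<longlonglongrightarrow> 1"
      using LIMSEQ_n_over_Suc_n[where 'a = real] by (simp add: one_ereal_def)
  qed auto
  finally show ?thesis by simp
qed

text \<open>Seen from side \<open>a\<close>, the pair play is \<open>w\<close> preceded by one step
  without target or reward, because mode 0 occurs at the start only and the deviator is fixed
  afterwards.\<close>

lemma payoff_pair:
  assumes A: "arena A" and obj: "objective_on A obj" and w: "play A v w"
    and \<pi>: "\<And>n. \<pi> n < length L" "mode (L ! \<pi> 0) = 0" "\<And>n. mode (L ! \<pi> (Suc n)) \<noteq> 0"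
      "\<And>n. deviator (L ! \<pi> (Suc n)) = i" "\<And>n. side a (L ! \<pi> (Suc n)) = w n"
  shows "payoff (pair_objective A L obj) a \<pi> = delayed obj (payoff obj i w)"
proof -
  have edge: "(w n, w (Suc n)) \<in> edges A" for n using w by (simp add: play_def)
  have rew0: "pair_rewards A L r a (\<pi> 0, \<pi> (Suc 0)) = 0"
    and rew: "pair_rewards A L r a (\<pi> (Suc n), \<pi> (Suc (Suc n))) = r i (w n, w (Suc n))" for r n
    using \<pi> edge by (simp_all add: pair_rewards_def)
  show ?thesis
  proof (cases obj)
    case (Parity \<kappa>)
    define g where "g = (\<lambda>x. side a (L ! x))"
    have "range \<pi> \<subseteq> {..<length L}" using \<pi>(1) by auto
    then have fin: "finite (range (suffix 1 \<pi>))"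
      by (rule finite_subset[rotated, OF finite_subset[OF _ finite_lessThan]]) auto
    have "w = g \<circ> suffix 1 \<pi>" using \<pi>(5) by (simp add: g_def fun_eq_iff)
    then have w_lim: "limit w = g ` limit (suffix 1 \<pi>)" using limit_map[OF fin] by simp
    have "deviator (L ! x) = i" if "x \<in> limit (suffix 1 \<pi>)" for x
      using that limit_in_range[of "suffix 1 \<pi>"] \<pi>(4) by auto
    then have "(\<lambda>x. \<kappa> (deviator (L ! x)) (side a (L ! x))) ` limit (suffix 1 \<pi>) = \<kappa> i ` limit w"
      unfolding w_lim g_def image_image by (intro image_cong) auto
    then show ?thesis by (simp add: Parity)
  next
    case (Mean_Payoff r)
    show ?thesis
      by (simp only: Mean_Payoff pair_objective.simps payoff.simps delayed.simps
          liminf_delayed_average[of "\<lambda>k. real_of_rat (pair_rewards A L r a (\<pi> k, \<pi> (Suc k)))"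
            "\<lambda>k. real_of_rat (r i (w k, w (Suc k)))", unfolded rew0 rew, OF of_rat_0 refl])
  next
    case (Quantitative_Reachability T)
    define P where "P n = (\<pi> n \<in> {x. x < length L \<and> mode (L ! x) \<noteq> 0 \<and> side a (L ! x) \<in> T (deviator (L ! x))})" for n
    have "\<not> P 0" "\<And>n. P (Suc n) \<longleftrightarrow> w n \<in> T i" using \<pi> by (auto simp: P_def)
    note L = Least_Suc_delayed[of P "\<lambda>n. w n \<in> T i", OF this]
    have "1 / (1 + real (Suc m)) = 1 / (1 + real m) / (1 + 1 / (1 + real m))" for m
    proof -
      have "1 + 1 / (1 + real m) = (1 + real (Suc m)) / (1 + real m)" by (simp add: field_simps)
      then show ?thesis by simp
    qed
    then have "(if \<exists>n. P n then 1 / (1 + real (LEAST n. P n)) else 0) =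
        (if \<exists>n. w n \<in> T i then 1 / (1 + real (LEAST n. w n \<in> T i)) else 0) /
        (1 + (if \<exists>n. w n \<in> T i then 1 / (1 + real (LEAST n. w n \<in> T i)) else 0))"
      using L by simp
    then show ?thesis by (simp only: Quantitative_Reachability pair_objective.simps payoff.simps delayed.simps P_def)
  next
    case (Energy r)
    have lev: "energy_level (pair_rewards A L r a) \<pi> (Suc n) = energy_level (r i) w n" for n
    proof (induction n)
      case 0
      show ?case by (simp add: rew0)
    next
      case (Suc n)
      have "energy_level (pair_rewards A L r a) \<pi> (Suc (Suc n)) =
          (case energy_level (pair_rewards A L r a) \<pi> (Suc n) of None \<Rightarrow> None
           | Some e \<Rightarrow> if 0 \<le> e + r i (w n, w (Suc n)) then Some (e + r i (w n, w (Suc n))) else None)"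
        by (subst energy_level.simps(2)) (simp only: rew)
      then show ?case unfolding Suc by simp
    qed
    have "(\<exists>n. energy_level (pair_rewards A L r a) \<pi> n = None) \<longleftrightarrow> (\<exists>n. energy_level (r i) w n = None)"
      by (rule Least_Suc_delayed(1)) (simp_all only: lev, simp)
    then show ?thesis by (simp add: Energy)
  next
    case (Discounted_Sum lam r)
    let ?f = "\<lambda>k. real_of_rat lam ^ k * real_of_rat (r i (w k, w (Suc k)))"
    let ?g = "\<lambda>k. real_of_rat lam ^ k * real_of_rat (pair_rewards A L r a (\<pi> k, \<pi> (Suc k)))"
    have lam: "0 < lam" "lam < 1" using obj Discounted_Sum by auto
    have g: "?g (Suc k) = real_of_rat lam * ?f k" for k by (simp add: rew)
    have f: "summable ?f" by (rule summable_discounted[OF A w lam])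
    then have "summable (\<lambda>k. ?g (Suc k))" unfolding g by (rule summable_mult)
    then have "summable ?g" by (subst (asm) summable_Suc_iff)
    from suminf_split_head[OF this] have "suminf ?g = (\<Sum>k. ?g (Suc k))" by (simp add: rew0)
    also have "\<dots> = real_of_rat lam * suminf ?f" unfolding g by (rule suminf_mult[OF f])
    finally show ?thesis by (simp add: Discounted_Sum)
  qed
qed

lemma nth_0_product: "xs \<noteq> [] \<Longrightarrow> ys \<noteq> [] \<Longrightarrow> List.product xs ys ! 0 = (xs ! 0, ys ! 0)"
  by (cases xs; cases ys) auto

lemma product_eq_Nil: "List.product xs ys = [] \<longleftrightarrow> xs = [] \<or> ys = []"
  by (metis length_0_conv length_product mult_eq_0_iff)

lemma cells_nonempty: "0 < k \<Longrightarrow> 0 < m \<Longrightarrow> 0 < n \<Longrightarrow> cells k m n \<noteq> []"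
  by (simp add: cells_def product_eq_Nil)

lemma cells_0: "0 < k \<Longrightarrow> 0 < m \<Longrightarrow> 0 < n \<Longrightarrow> cells k m n ! 0 = (0, 0, 0, 0, 0, 0)"
  by (simp add: cells_def product_eq_Nil nth_0_product del: upt_Suc)

lemma set_cells:
  "set (cells k m n) = {0..<3} \<times> {0..<k} \<times> {0..<m} \<times> {0..<n} \<times> {0..<m} \<times> {0..<n}"
  by (simp add: cells_def)

section \<open>Plays of the pair arena as pairs of plays\<close>

locale mealy_instance =
  fixes A :: "(nat, nat) arena" and v0 :: nat and M :: "(nat, nat) mealy" and k m n :: nat
  assumes arena: "arena A" and players: "players A = {..<k}" and verts: "verts A = {..<n}"
    and v0: "v0 < n" and machine: "mealy_machine A M" and states: "states M = {..<m}"
begin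

abbreviation "L \<equiv> arena_cells A M"

lemma L_eq: "L = cells k m n"
  by (simp add: arena_cells_def players verts states)

lemma deltaD:
  assumes "(p, u, q, w) \<in> delta M"
  shows "p < m" "u < n" "q < m" "w < n" "(u, w) \<in> edges A"
  using assms machine unfolding mealy_machine_def states verts by blast+

lemma edgeD: "(u, w) \<in> edges A \<Longrightarrow> u < n \<and> w < n"
  using arena unfolding arena_def verts by blast

lemma start: "start M < m"
  using machine unfolding mealy_machine_def states by simp

lemma positive_sizes: "0 < k" "0 < m" "0 < n"
proof -
  obtain i where "i \<in> players A" "v0 \<in> part A i" using arena v0 unfolding arena_def verts by blast
  then show "0 < k" by (auto simp: players)
qed (use start v0 in auto)

lemma L_0: "L ! 0 = (0, 0, 0, 0, 0, 0)" and L_nonempty: "L \<noteq> []"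
  unfolding L_eq using positive_sizes by (simp_all add: cells_0 cells_nonempty)

lemma in_L: "(b, i, p, u, p', u') \<in> set L \<longleftrightarrow> b < 3 \<and> i < k \<and> p < m \<and> u < n \<and> p' < m \<and> u' < n"
  by (simp add: L_eq set_cells)

lemma L_cases:
  assumes "x < length L"
  obtains b i p u p' u' where "L ! x = (b, i, p, u, p', u')"
    "b < 3" "i < k" "p < m" "u < n" "p' < m" "u' < n"
  using assms in_L nth_mem[OF assms] by (cases "L ! x") auto

text \<open>Unreachable cells need successors too. Apart from the opening move, the witness keeps
  the mode and follows the machine; in mode 1 the second side is overwritten by a copy of the
  first.\<close>

lemma cell_step_total:
  assumes "x < length L"
  shows "\<exists>c\<in>set L. cell_step sp A v0 M (L ! x) c"
proof -
  obtain b i p u p' u' where x: "L ! x = (b, i, p, u, p', u')"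
    "b < 3" "i < k" "p < m" "u < n" "p' < m" "u' < n" using L_cases[OF assms] .
  obtain q w where d: "(p, u, q, w) \<in> delta M"
    using machine x(4,5) unfolding mealy_machine_def states verts by blast
  obtain q' w' where d': "(p', u', q', w') \<in> delta M"
    using machine x(6,7) unfolding mealy_machine_def states verts by blast
  have w: "w \<in> verts A" using deltaD(4)[OF d] by (simp add: verts)
  consider "b = 0" | "b = 1" | "b = 2" using x(2) by linarith
  then show ?thesis
  proof cases
    case 1
    then show ?thesis
      using x start v0 by (intro bexI[of _ "(1, i, start M, v0, start M, v0)"]) (auto simp: in_L)
  next
    case 2
    then show ?thesis
      using x d deltaD[OF d] w by (intro bexI[of _ "(1, i, q, w, q, w)"]) (auto simp: in_L)
  next
    case 3
    then show ?thesis
      using x d d' deltaD[OF d] deltaD[OF d']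
      by (intro bexI[of _ "(2, i, q, w, q', w')"]) (auto simp: in_L)
  qed
qed

lemma arena_pair_arena: "arena (pair_arena sp A v0 M)"
proof -
  have "\<exists>y. y < length L \<and> cell_step sp A v0 M (L ! x) (L ! y)" if "x < length L" for x
    using cell_step_total[OF that, of sp] unfolding Bex_def in_set_conv_nth by blast
  then show ?thesis
    unfolding arena_def pair_arena_def Let_def by (auto simp: disjoint_family_on_def)
qed

definition index :: "cell \<Rightarrow> nat" where
  "index c = (SOME x. x < length L \<and> L ! x = c)"

lemma index: "c \<in> set L \<Longrightarrow> index c < length L \<and> L ! index c = c"
  unfolding index_def by (rule someI_ex) (metis in_set_conv_nth)

lemma play_of_deviation:
  assumes i: "i < k" and dev: "deviation sp A v0 M i \<alpha> \<beta>"
  obtains \<pi> where "play (pair_arena sp A v0 M) 0 \<pi>"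
    "\<forall>n. mode (L ! \<pi> (Suc n)) \<noteq> 0" "\<forall>n. deviator (L ! \<pi> (Suc n)) = i"
    "\<forall>n. side 0 (L ! \<pi> (Suc n)) = \<alpha> n" "\<forall>n. side 1 (L ! \<pi> (Suc n)) = \<beta> n"
proof -
  obtain d r r' where play: "play A v0 \<alpha>" "play A v0 \<beta>" and r: "r 0 = start M"
    and below: "\<And>n. n \<le> d \<Longrightarrow> \<alpha> n = \<beta> n" and split: "\<alpha> (Suc d) \<noteq> \<beta> (Suc d)"
    and r': "\<And>n. n \<le> Suc d \<Longrightarrow> r' n = r n" and d: "\<beta> d \<in> part A i"
    and ta: "\<And>n. \<exists>x. (r n, \<alpha> n, r (Suc n), x) \<in> delta M \<and> (sp \<and> n < d \<or> x = \<alpha> (Suc n))"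
    and tb: "\<And>n. n > d \<Longrightarrow> \<exists>x. (r' n, \<beta> n, r' (Suc n), x) \<in> delta M \<and> (\<beta> n \<in> part A i \<or> x = \<beta> (Suc n))"
    using dev unfolding deviation_def by blast
  \<comment> \<open>The separating step leads from index \<open>d\<close> to \<open>Suc d\<close>,
    so the cell at \<open>d\<close> still has mode 1.\<close>
  define c where "c n = (if n \<le> d then 1 else 2 :: nat, i, r n, \<alpha> n, r' n, \<beta> n)" for n
  have edge: "(\<alpha> n, \<alpha> (Suc n)) \<in> edges A" "(\<beta> n, \<beta> (Suc n)) \<in> edges A" for n
    using play by (auto simp: play_def)
  have "r n < m" for n using ta[of n] deltaD(1) by blast
  moreover have "r' n < m" for n
    using calculation[of n] r'[of n] tb[of n] deltaD(1) by (metis not_less_eq_eq le_SucI not_le)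
  ultimately have c: "c n \<in> set L" for n
    using i edgeD[OF edge(1)] edgeD[OF edge(2)] by (simp add: c_def in_L)
  have step: "cell_step sp A v0 M (c n) (c (Suc n))" for n
  proof -
    obtain x where x: "(r n, \<alpha> n, r (Suc n), x) \<in> delta M" "sp \<and> n < d \<or> x = \<alpha> (Suc n)"
      using ta by blast
    have xv: "x \<in> verts A" using deltaD(4)[OF x(1)] by (simp add: verts)
    consider "n < d" | "n = d" | "n > d" by linarith
    then show ?thesis
    proof cases
      case 1
      then show ?thesis using x xv below[of "Suc n"] r'[of "Suc n"] edge(1)[of n] by (auto simp: c_def)
    next
      case 2
      then show ?thesis
        using x split r'[of "Suc n"] below[of n] d edge(2)[of n] by (auto simp: c_def)
    next
      case 3
      obtain y where y: "(r' n, \<beta> n, r' (Suc n), y) \<in> delta M" "\<beta> n \<in> part A i \<or> y = \<beta> (Suc n)"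
        using tb[OF 3] by blast
      have "y \<in> verts A" using deltaD(4)[OF y(1)] by (simp add: verts)
      then show ?thesis using 3 x y edge(2)[of n] by (auto simp: c_def)
    qed
  qed
  \<comment> \<open>The initial cell is put in front, so \<open>\<pi> (Suc n)\<close> carries the
    vertices at time \<open>n\<close>.\<close>
  define \<pi> where "\<pi> = case_nat 0 (\<lambda>n. index (c n))"
  have \<pi>0: "\<pi> 0 = 0" and \<pi>S: "L ! \<pi> (Suc n) = c n" "\<pi> (Suc n) < length L" for n
    using index[OF c] by (auto simp: \<pi>_def)
  have c0: "c 0 = (1, i, start M, v0, start M, v0)"
    using r r'[of 0] play by (simp add: c_def play_def)
  have "(\<pi> n, \<pi> (Suc n)) \<in> edges (pair_arena sp A v0 M)" for n
  proof (cases n)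
    case 0
    then show ?thesis
      using \<pi>S[of 0] L_nonempty by (simp add: pair_arena_def Let_def \<pi>0 L_0 c0)
  next
    case (Suc l)
    then show ?thesis using \<pi>S[of l] \<pi>S[of "Suc l"] step[of l] by (simp add: pair_arena_def Let_def)
  qed
  then have "play (pair_arena sp A v0 M) 0 \<pi>" by (simp add: play_def \<pi>0)
  then show ?thesis by (rule that) (auto simp: \<pi>S c_def)
qed

text \<open>The alternative \<open>\<alpha> = \<beta>\<close> covers the plays that stay in mode 1
  forever: both their sides earn the same payoff.\<close>

lemma deviation_of_play:
  assumes \<pi>: "play (pair_arena sp A v0 M) 0 \<pi>"
  obtains i \<alpha> \<beta> where "i < k" "play A v0 \<alpha>" "play A v0 \<beta>"
    "\<forall>n. mode (L ! \<pi> (Suc n)) \<noteq> 0" "\<forall>n. deviator (L ! \<pi> (Suc n)) = i"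
    "\<forall>n. side 0 (L ! \<pi> (Suc n)) = \<alpha> n" "\<forall>n. side 1 (L ! \<pi> (Suc n)) = \<beta> n"
    "\<alpha> = \<beta> \<or> deviation sp A v0 M i \<alpha> \<beta>"
proof -
  have len: "\<pi> n < length L" and step: "cell_step sp A v0 M (L ! \<pi> n) (L ! \<pi> (Suc n))" for n
    using \<pi> by (auto simp: play_def pair_arena_def Let_def)
  have "\<forall>l. \<exists>b j p u p' u'. L ! \<pi> (Suc l) = (b, j, p, u, p', u') \<and> j < k"
    using L_cases[OF len] by metis
  then obtain b j r \<alpha> r' \<beta> where c: "\<And>l. L ! \<pi> (Suc l) = (b l, j l, r l, \<alpha> l, r' l, \<beta> l)"
      and jk: "\<And>l. j l < k"
    by metis
  have c0: "b 0 = 1" "r 0 = start M" "r' 0 = start M" "\<alpha> 0 = v0" "\<beta> 0 = v0"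
    using step[of 0] \<pi> by (simp_all add: play_def L_0 c)
  have cS: "cell_step sp A v0 M (b l, j l, r l, \<alpha> l, r' l, \<beta> l)
      (b (Suc l), j (Suc l), r (Suc l), \<alpha> (Suc l), r' (Suc l), \<beta> (Suc l))" for l
    using step[of "Suc l"] by (simp only: c)
  have b: "b l = 1 \<or> b l = 2" for l
    by (induction l) (use c0 cS in \<open>auto simp del: One_nat_def\<close>)
  have j: "j l = j 0" for l
  proof (induction l)
    case (Suc l)
    then show ?case using cS[of l] b[of l] by auto
  qed simp
  have b2: "b (Suc l) = 2" if "b l = 2" for l using cS[of l] that by auto
  have b1: "r' l = r l \<and> \<beta> l = \<alpha> l" if "b l = 1" for l
  proof (cases l)
    case 0
    then show ?thesis using c0 by simp
  next
    case (Suc l')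
    then show ?thesis using cS[of l'] b[of l'] that by auto
  qed
  have edge: "(\<alpha> l, \<alpha> (Suc l)) \<in> edges A" "(\<beta> l, \<beta> (Suc l)) \<in> edges A" for l
    using cS[of l] b[of l] b1[of l] by (auto split: if_splits dest: deltaD(5))
  have play: "play A v0 \<alpha>" "play A v0 \<beta>" using edge c0 by (auto simp: play_def)
  have "deviation sp A v0 M (j 0) \<alpha> \<beta>" if "\<alpha> \<noteq> \<beta>"
  proof -
    have ex: "\<exists>l. b l = 2" using that b b1 by (metis ext)
    \<comment> \<open>Mode 2 is entered exactly when the vertices part, so the entry time is
      \<open>Suc d\<close>.\<close>
    define N where "N = (LEAST l. b l = 2)"
    have N: "b N = 2" unfolding N_def using ex by (rule LeastI_ex)
    have below: "b l = 1" if "l < N" for l using b[of l] not_less_Least that unfolding N_def by blast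
    have "N \<noteq> 0" using N c0(1) by (metis n_not_Suc_n numeral_2_eq_2 One_nat_def)
    then obtain d where d: "N = Suc d" using not0_implies_Suc by blast
    have above: "b l = 2" if "l \<ge> N" for l using that by (induction rule: dec_induct) (use N b2 in auto)
    have bd: "b d = 1" "b (Suc d) = 2" using below d N by auto
    have sd: "r' (Suc d) = r (Suc d)" "\<alpha> (Suc d) \<noteq> \<beta> (Suc d)"
        "(r d, \<alpha> d, r (Suc d), \<alpha> (Suc d)) \<in> delta M" "\<alpha> d \<in> part A (j d)"
      using cS[of d] bd by auto
    show ?thesis
      unfolding deviation_def
    proof (rule conjI, fact play(1), rule conjI, fact play(2), rule exI[of _ d],
        rule exI[of _ r], rule exI[of _ r'], intro conjI allI impI)
      show "r 0 = start M" by (rule c0)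
      show "\<alpha> l = \<beta> l" if "l \<le> d" for l using b1[of l] below[of l] that d by simp
      show "\<alpha> (Suc d) \<noteq> \<beta> (Suc d)" by (rule sd)
      show "r' l = r l" if "l \<le> Suc d" for l
        using b1[of l] below[of l] that d sd(1) by (cases "l = Suc d") auto
      show "\<beta> d \<in> part A (j 0)" using sd(4) b1[OF bd(1)] j[of d] by simp
      show "\<exists>x. (r l, \<alpha> l, r (Suc l), x) \<in> delta M \<and> (sp \<and> l < d \<or> x = \<alpha> (Suc l))" for l
      proof -
        consider "l < d" | "l = d" | "l > d" by linarith
        then show ?thesis
        proof cases
          case 1
          then show ?thesis using cS[of l] below[of l] below[of "Suc l"] d by (auto split: if_splits)
        next
          case 2
          then show ?thesis using sd(3) by blast
        next
          case 3
          then show ?thesis using cS[of l] above[of l] d by auto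
        qed
      qed
      show "\<exists>x. (r' l, \<beta> l, r' (Suc l), x) \<in> delta M \<and> (\<beta> l \<in> part A (j 0) \<or> x = \<beta> (Suc l))"
        if "d < l" for l
        using cS[of l] above[of l] d that j[of l] by auto
    qed
  qed
  then have "\<alpha> = \<beta> \<or> deviation sp A v0 M (j 0) \<alpha> \<beta>" by blast
  then have dev: "\<alpha> = \<beta> \<or> deviation sp A v0 M (j 0) \<alpha> \<beta>" by blast
  have "mode (L ! \<pi> (Suc l)) \<noteq> 0" for l using b[of l] by (auto simp: c)
  then have "\<forall>l. mode (L ! \<pi> (Suc l)) \<noteq> 0" ..
  from that[OF jk[of 0] play this _ _ _ dev] show ?thesis using j by (simp add: c)
qed

lemma unprivileged_iff_deviation:
  assumes obj: "objective_on A obj"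
  shows "(\<exists>\<pi>. play (pair_arena sp A v0 M) 0 \<pi> \<and>
       payoff (pair_objective A L obj) 0 \<pi> < payoff (pair_objective A L obj) 1 \<pi>) \<longleftrightarrow>
     (\<exists>i\<in>players A. \<exists>\<alpha> \<beta>. deviation sp A v0 M i \<alpha> \<beta> \<and> payoff obj i \<alpha> < payoff obj i \<beta>)"
    (is "?l \<longleftrightarrow> ?r")
proof -
  have len: "\<pi> l < length L" and m0: "mode (L ! \<pi> 0) = 0"
    if "play (pair_arena sp A v0 M) 0 \<pi>" for \<pi> l
    using that by (auto simp: play_def pair_arena_def Let_def L_0)
  have pay: "payoff (pair_objective A L obj) 0 \<pi> < payoff (pair_objective A L obj) 1 \<pi> \<longleftrightarrow>
      payoff obj i \<alpha> < payoff obj i \<beta>"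
    if \<pi>: "play (pair_arena sp A v0 M) 0 \<pi>" and p: "play A v0 \<alpha>" "play A v0 \<beta>" and
      c: "\<forall>n. mode (L ! \<pi> (Suc n)) \<noteq> 0" "\<forall>n. deviator (L ! \<pi> (Suc n)) = i"
      "\<forall>n. side 0 (L ! \<pi> (Suc n)) = \<alpha> n" "\<forall>n. side 1 (L ! \<pi> (Suc n)) = \<beta> n" for \<pi> i \<alpha> \<beta>
    unfolding payoff_pair[where \<pi> = \<pi>, OF arena obj p(1) len[OF \<pi>] m0[OF \<pi>] c(1,2,3)[rule_format]]
      payoff_pair[where \<pi> = \<pi>, OF arena obj p(2) len[OF \<pi>] m0[OF \<pi>] c(1,2,4)[rule_format]]
    by (rule delayed_less[OF obj])
  show ?thesis
  proof
    assume ?l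
    then obtain \<pi> where \<pi>: "play (pair_arena sp A v0 M) 0 \<pi>"
      and less: "payoff (pair_objective A L obj) 0 \<pi> < payoff (pair_objective A L obj) 1 \<pi>" by blast
    obtain i \<alpha> \<beta> where i: "i < k" and d: "play A v0 \<alpha>" "play A v0 \<beta>"
      "\<forall>n. mode (L ! \<pi> (Suc n)) \<noteq> 0" "\<forall>n. deviator (L ! \<pi> (Suc n)) = i"
      "\<forall>n. side 0 (L ! \<pi> (Suc n)) = \<alpha> n" "\<forall>n. side 1 (L ! \<pi> (Suc n)) = \<beta> n"
      and dev: "\<alpha> = \<beta> \<or> deviation sp A v0 M i \<alpha> \<beta>"
      using deviation_of_play[OF \<pi>] .
    have "payoff obj i \<alpha> < payoff obj i \<beta>" using less pay[OF \<pi> d] by simp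
    then show ?r using dev i by (auto simp: players)
  next
    assume ?r
    then obtain i \<alpha> \<beta> where i: "i < k" and dev: "deviation sp A v0 M i \<alpha> \<beta>"
      and less: "payoff obj i \<alpha> < payoff obj i \<beta>" by (auto simp: players)
    obtain \<pi> where \<pi>: "play (pair_arena sp A v0 M) 0 \<pi>"
      "\<forall>n. mode (L ! \<pi> (Suc n)) \<noteq> 0" "\<forall>n. deviator (L ! \<pi> (Suc n)) = i"
      "\<forall>n. side 0 (L ! \<pi> (Suc n)) = \<alpha> n" "\<forall>n. side 1 (L ! \<pi> (Suc n)) = \<beta> n"
      using play_of_deviation[OF i dev] .
    have "play A v0 \<alpha>" "play A v0 \<beta>" using dev by (auto simp: deviation_def)
    then show ?l using pay[OF \<pi>(1) _ _ \<pi>(2-)] less \<pi>(1) by blast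
  qed
qed

lemma violated_iff_unprivileged:
  assumes "objective_on A obj"
  shows "(\<exists>\<sigma>\<in>Comp A v0 M. violated sp A (payoff obj) v0 \<sigma>) \<longleftrightarrow>
     (\<exists>\<pi>. play (pair_arena sp A v0 M) 0 \<pi> \<and>
       payoff (pair_objective A L obj) 0 \<pi> < payoff (pair_objective A L obj) 1 \<pi>)"
proof -
  have "v0 \<in> verts A" using v0 by (simp add: verts)
  then show ?thesis
    unfolding unprivileged_iff_deviation[OF assms]
    using deviation_if_violated[OF arena, of v0 _ M sp "payoff obj"]
      violated_if_deviation[OF arena _ machine, of v0 _ sp _ _ "payoff obj"] by blast
qed

end


section \<open>The reduction\<close>

text \<open>Unary components can be used as table positions at once, and the nesting to the right is
  the one produced by iterating \<open>tproduct\<close>.\<close>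

fun enc_cell :: "cell \<Rightarrow> tree" where
  "enc_cell (b, i, p, u, p', u') =
     Node (unary b) (Node (unary i) (Node (unary p) (Node (unary u) (Node (unary p') (unary u')))))"

abbreviation "cell_mode c \<equiv> left c"
abbreviation "cell_deviator c \<equiv> left (right c)"
abbreviation "cell_state c \<equiv> left (right (right c))"
abbreviation "cell_vertex c \<equiv> left (right (right (right c)))"
abbreviation "cell_state' c \<equiv> left (right (right (right (right c))))"
abbreviation "cell_vertex' c \<equiv> right (right (right (right (right c))))"

abbreviation "in_parts x \<equiv> left (left (left x))"
abbreviation "in_edges x \<equiv> right (left (left x))"
abbreviation "in_objective x \<equiv> left (right (left x))"
abbreviation "in_initial x \<equiv> right (right (left x))"
abbreviation "in_start x \<equiv> left (right x)"
abbreviation "in_delta x \<equiv> right (right x)"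

text \<open>An input does not state its numbers of players, states and vertices; they are the
  lengths of the ownership, transition and edge tables.\<close>

definition tcells :: "tree \<Rightarrow> tree" where
  "tcells x = (let P = iota (in_parts x); Q = iota (in_delta x); V = iota (in_edges x) in
     tproduct (enc_list unary [0..<3]) (tproduct P (tproduct Q (tproduct V (tproduct Q V)))))"

definition tcell_step :: "bool \<Rightarrow> tree \<Rightarrow> tree \<Rightarrow> tree \<Rightarrow> tree" where
  "tcell_step sp x c d =
     (let mode_is = \<lambda>c b. teq (cell_mode c) (unary b);
          i = cell_deviator c;
          u = cell_vertex c; w = cell_vertex d; u' = cell_vertex' c; w' = cell_vertex' d;
          edge = \<lambda>u w. tnth w (tnth u (in_edges x));
          owned = \<lambda>u. tnth u (tnth i (in_parts x));
          moves = tnth (cell_state d) (tnth u (tnth (cell_state c) (in_delta x)));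
          moves' = tnth (cell_state' d) (tnth u' (tnth (cell_state' c) (in_delta x)));
          q0 = unary_of_binary (in_delta x) (in_start x);
          v0 = unary_of_binary (in_edges x) (in_initial x)
      in tor
        (tand (mode_is c 0) (tand (mode_is d 1) (tand (teq (cell_state d) q0)
          (tand (teq (cell_state' d) q0) (tand (teq w v0) (teq w' v0))))))
        (tand (tnot (mode_is c 0)) (tand (teq (cell_deviator d) i) (tor
          (tand (mode_is c 1) (tand (teq (cell_state' d) (cell_state d)) (tor
            (tand (mode_is d 1) (tand (teq w' w) (tand (edge u w) (if sp then tany moves else tnth w moves))))
            (tand (mode_is d 2) (tand (tnot (teq w' w)) (tand (tnth w moves) (tand (owned u) (edge u w'))))))))
          (tand (mode_is c 2) (tand (mode_is d 2) (tand (tnth w moves)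
            (tor (tnth w' moves') (tand (owned u') (tand (edge u' w') (tany moves')))))))))))"

text \<open>One table for each of players A and E; the argument handed to \<open>f\<close> selects
  the vertex of the corresponding side.\<close>

definition ttables :: "((tree \<Rightarrow> tree) \<Rightarrow> tree) \<Rightarrow> tree" where
  "ttables f = Node (f (\<lambda>c. cell_vertex c)) (Node (f (\<lambda>c. cell_vertex' c)) Leaf)"

definition trewards :: "bool \<Rightarrow> tree \<Rightarrow> tree \<Rightarrow> tree" where
  "trewards sp x r = ttables (\<lambda>s. tmap (\<lambda>c. tmap (\<lambda>d.
     tif (tand (cell_mode c) (tcell_step sp x c d)) (tnth (s d) (tnth (s c) (tnth (cell_deviator c) r)))
       (enc_rat 0)) (tcells x)) (tcells x))"

text \<open>Colours, rewards and the discount factor are copied as uninspected trees, so no binary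
  arithmetic arises.\<close>

fun tobjective :: "game_class \<Rightarrow> bool \<Rightarrow> tree \<Rightarrow> tree" where
  "tobjective Parity_Games sp x =
     ttables (\<lambda>s. tmap (\<lambda>c. tnth (s c) (tnth (cell_deviator c) (in_objective x))) (tcells x))"
| "tobjective Mean_Payoff_Games sp x = trewards sp x (in_objective x)"
| "tobjective Quantitative_Reachability_Games sp x =
     ttables (\<lambda>s. tmap (\<lambda>c. tif (cell_mode c) (tnth (s c) (tnth (cell_deviator c) (in_objective x))) Leaf)
       (tcells x))"
| "tobjective Energy_Games sp x = trewards sp x (in_objective x)"
| "tobjective Discounted_Sum_Games sp x =
     Node (left (in_objective x)) (trewards sp x (right (in_objective x)))"

definition treduct :: "game_class \<Rightarrow> bool \<Rightarrow> tree \<Rightarrow> tree" where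
  "treduct C sp x =
     Node
       (Node (Node (tmap (\<lambda>c. enc_bool True) (tcells x)) (Node (tmap (\<lambda>c. enc_bool False) (tcells x)) Leaf))
         (tmap (\<lambda>c. tmap (\<lambda>d. tcell_step sp x c d) (tcells x)) (tcells x)))
       (Node (tobjective C sp x) (enc_nat 0))"

lemma poly_time_tcells: "poly_time f \<Longrightarrow> poly_time (\<lambda>z. tcells (f z))"
  unfolding tcells_def Let_def by (intro poly_time_intros)

lemma poly_time_if: "poly_time f \<Longrightarrow> poly_time g \<Longrightarrow> poly_time (\<lambda>z. if b then f z else g z)"
  by (cases b) auto

lemma poly_time_tcell_step:
  "poly_time f \<Longrightarrow> poly_time g \<Longrightarrow> poly_time h \<Longrightarrow> poly_time (\<lambda>z. tcell_step sp (f z) (g z) (h z))"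
  unfolding tcell_step_def Let_def by (intro poly_time_intros poly_time_if)

lemma poly_time_trewards:
  assumes "poly_time f" "poly_time g"
  shows "poly_time (\<lambda>z. trewards sp (f z) (g z))"
proof (rule poly_time_apply2[OF _ assms])
  show "poly_time (\<lambda>z. trewards sp (left z) (right z))"
    unfolding trewards_def ttables_def
    by (intro poly_time_intros poly_time_tcells poly_time_tcell_step)
qed

lemma poly_time_treduct: "poly_time (treduct C sp)"
proof -
  have "poly_time (\<lambda>x. tobjective C sp x)"
    by (cases C)
      (simp_all only: tobjective.simps ttables_def,
        (intro poly_time_intros poly_time_tcells poly_time_trewards)+)
  then have "poly_time (\<lambda>x. treduct C sp x)"
    unfolding treduct_def by (intro poly_time_intros poly_time_tcells poly_time_tcell_step)
  then show ?thesis by simp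
qed

section \<open>Correctness of the tree function on codes of inputs\<close>

lemma length_dec_list_enc_table [simp]: "length (dec_list (enc_table n f)) = n"
  by (simp add: enc_table_def)

lemma enc_table_nth:
  assumes "\<And>j. j < length cs \<Longrightarrow> f j = g (cs ! j)"
  shows "enc_table (length cs) f = enc_list g cs"
proof -
  have "enc_table (length cs) f = enc_list (\<lambda>j. g (cs ! j)) [0..<length cs]"
    unfolding enc_table_def using assms by (intro enc_list_cong) auto
  also have "\<dots> = enc_list g (map ((!) cs) [0..<length cs])"
    by (simp only: enc_list_map)
  finally show ?thesis by (simp add: map_nth)
qed

lemma enc_table_2: "enc_table 2 f = Node (f 0) (Node (f 1) Leaf)"
  by (simp add: enc_table_def numeral_2_eq_2)

context mealy_instance
begin

definition input_code :: "(nat, nat) objective \<Rightarrow> tree" where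
  "input_code obj = enc_checking (\<lparr> arena_of = A, objective_of = obj, initial = v0 \<rparr>, M)"

lemma input_code:
  "in_parts (input_code obj) = enc_table k (\<lambda>i. enc_table n (\<lambda>v. enc_bool (v \<in> part A i)))"
  "in_edges (input_code obj) = enc_table n (\<lambda>u. enc_table n (\<lambda>v. enc_bool ((u, v) \<in> edges A)))"
  "in_objective (input_code obj) = enc_objective A obj"
  "in_initial (input_code obj) = enc_nat v0"
  "in_start (input_code obj) = enc_nat (start M)"
  "in_delta (input_code obj) = enc_table m (\<lambda>p. enc_table n (\<lambda>u. enc_table m (\<lambda>q. enc_table n (\<lambda>v.
      enc_bool ((p, u, q, v) \<in> delta M)))))"
  by (simp_all add: input_code_def enc_checking_def enc_game_def enc_arena_def enc_mealy_def Let_def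
      players verts states)

text \<open>Rewritten as nested pair encodings, \<open>enc_cell\<close> matches the five
  applications of \<open>tproduct_enc_list\<close>.\<close>

lemma tcells_input_code: "tcells (input_code obj) = enc_list enc_cell L"
proof -
  have "enc_cell = (\<lambda>(x, y). Node (unary x) ((\<lambda>(x, y). Node (unary x) ((\<lambda>(x, y). Node (unary x)
      ((\<lambda>(x, y). Node (unary x) ((\<lambda>(x, y). Node (unary x) (unary y)) y)) y)) y)) y))"
    by (auto simp: fun_eq_iff)
  then show ?thesis
    unfolding tcells_def Let_def input_code iota_eq length_dec_list_enc_table tproduct_enc_list L_eq cells_def
    by (simp only:)
qed

lemma tany_table: "tany (enc_table n (\<lambda>v. enc_bool (P v))) = enc_bool (\<exists>v\<in>verts A. P v)"
  unfolding enc_table_def tany_enc_list by (simp add: verts lessThan_atLeast0)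

text \<open>Membership in \<open>L\<close> bounds every component, which puts all lookups within
  range of their tables.\<close>

lemma tcell_step_input_code:
  assumes "c \<in> set L" "d \<in> set L"
  shows "tcell_step sp (input_code obj) (enc_cell c) (enc_cell d) = enc_bool (cell_step sp A v0 M c d)"
proof -
  obtain b i p u p' u' where c: "c = (b, i, p, u, p', u')" by (cases c)
  obtain b2 j q w q' w' where d: "d = (b2, j, q, w, q', w')" by (cases d)
  show ?thesis
    using assms start v0 unfolding c d in_L
    by (cases sp) (simp_all only: tcell_step_def Let_def input_code enc_cell.simps left_simps right_simps
        tnth_table tany_table teq_unary tor_enc_bool tand_enc_bool tnot_enc_bool unary_of_binary_enc_nat
        length_dec_list_enc_table cell_step.simps if_True if_False simp_thms)
qed

lemma table_input_code:
  assumes "\<And>c. c \<in> set L \<Longrightarrow> F c = g (enc_cell c)" "\<And>j. j < length L \<Longrightarrow> f j = F (L ! j)"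
  shows "enc_table (length L) f = tmap g (tcells (input_code obj))"
  unfolding tcells_input_code tmap_enc_list by (rule enc_table_nth) (use assms in auto)

lemma pair_arena_simps:
  "players (pair_arena sp A v0 M) = {0, 1}" "verts (pair_arena sp A v0 M) = {..<length L}"
  "part (pair_arena sp A v0 M) i = (if i = 0 then {..<length L} else {})"
  "(x, y) \<in> edges (pair_arena sp A v0 M) \<longleftrightarrow>
     x < length L \<and> y < length L \<and> cell_step sp A v0 M (L ! x) (L ! y)"
  by (simp_all add: pair_arena_def Let_def)

end

context mealy_instance
begin

definition pair_game :: "bool \<Rightarrow> (nat, nat) objective \<Rightarrow> game_input" where
  "pair_game sp obj =
     \<lparr> arena_of = pair_arena sp A v0 M, objective_of = pair_objective A L obj, initial = 0 \<rparr>"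

lemma ttables_eq:
  assumes "\<And>a s. s = (if a = 0 then (\<lambda>c. cell_vertex c) else (\<lambda>c. cell_vertex' c)) \<Longrightarrow> f a = g s"
  shows "enc_table 2 f = ttables g"
  unfolding enc_table_2 ttables_def using assms[of _ 0] assms[of _ 1] by simp

lemma vertex_enc_cell:
  "(if a = 0 then (\<lambda>c. cell_vertex c) else (\<lambda>c. cell_vertex' c)) (enc_cell c) = unary (side a c)"
  by (cases c) simp

lemma cell_mode_enc_cell: "cell_mode (enc_cell c) = unary (mode c)"
  by (cases c) simp

lemma cell_deviator_enc_cell: "cell_deviator (enc_cell c) = unary (deviator c)"
  by (cases c) simp

lemma in_L_bounds:
  assumes "c \<in> set L"
  shows "deviator c < k" "side a c < n"
proof -
  obtain b i p u p' u' where c: "c = (b, i, p, u, p', u')" by (cases c)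
  show "deviator c < k" "side a c < n" using assms unfolding c in_L by simp_all
qed

lemma card_pair_arena:
  "card (players (pair_arena sp A v0 M)) = 2" "card (verts (pair_arena sp A v0 M)) = length L"
  by (simp_all add: pair_arena_simps)

lemma enc_rewards_pair:
  assumes r: "r' = enc_rewards A r"
  shows "enc_rewards (pair_arena sp A v0 M) (pair_rewards A L r) = trewards sp (input_code obj) r'"
  unfolding enc_rewards_def Let_def card_pair_arena trewards_def
proof (rule ttables_eq)
  fix a :: nat and s
  assume s: "s = (if a = 0 then (\<lambda>c. cell_vertex c) else (\<lambda>c. cell_vertex' c))"
  let ?F = "\<lambda>c d. enc_rat (if cell_step sp A v0 M c d \<and> mode c \<noteq> 0 then
      (if (side a c, side a d) \<in> edges A then r (deviator c) (side a c, side a d) else 0) else 0)"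
  \<comment> \<open>The input table holds 0 off the edges, so the lookup equals the guarded reward
    for every pair of cells, reachable or not.\<close>
  have lookup: "tnth (s (enc_cell d)) (tnth (s (enc_cell c)) (tnth (cell_deviator (enc_cell c)) r')) =
      enc_rat (if (side a c, side a d) \<in> edges A then r (deviator c) (side a c, side a d) else 0)"
    if "c \<in> set L" "d \<in> set L" for c d
    using in_L_bounds[OF that(1)] in_L_bounds[OF that(2)]
    unfolding s vertex_enc_cell cell_deviator_enc_cell r enc_rewards_def Let_def
    by (simp add: players verts)
  have "tif (tand (cell_mode (enc_cell c)) (tcell_step sp (input_code obj) (enc_cell c) (enc_cell d)))
      (tnth (s (enc_cell d)) (tnth (s (enc_cell c)) (tnth (cell_deviator (enc_cell c)) r'))) (enc_rat 0) =
      ?F c d" if "c \<in> set L" "d \<in> set L" for c d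
    unfolding lookup[OF that] tcell_step_input_code[OF that] cell_mode_enc_cell
    by (simp add: tif_def tand_def)
  note F = this[symmetric]
  show "enc_table (length L) (\<lambda>x. enc_table (length L) (\<lambda>y. enc_rat
      (if (x, y) \<in> edges (pair_arena sp A v0 M) then pair_rewards A L r a (x, y) else 0))) =
    tmap (\<lambda>c. tmap (\<lambda>d. tif (tand (cell_mode c) (tcell_step sp (input_code obj) c d))
      (tnth (s d) (tnth (s c) (tnth (cell_deviator c) r'))) (enc_rat 0)) (tcells (input_code obj)))
      (tcells (input_code obj))"
  proof (rule table_input_code)
    fix x assume x: "x < length L"
    show "enc_table (length L) (\<lambda>y. enc_rat
        (if (x, y) \<in> edges (pair_arena sp A v0 M) then pair_rewards A L r a (x, y) else 0)) =
      enc_list (?F (L ! x)) L"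
      by (rule enc_table_nth) (use x in \<open>auto simp: pair_arena_simps pair_rewards_def\<close>)
  next
    fix c assume "c \<in> set L"
    then show "enc_list (?F c) L = tmap (\<lambda>d. tif (tand (cell_mode (enc_cell c))
        (tcell_step sp (input_code obj) (enc_cell c) d))
        (tnth (s d) (tnth (s (enc_cell c)) (tnth (cell_deviator (enc_cell c)) r'))) (enc_rat 0))
        (tcells (input_code obj))"
      unfolding tcells_input_code tmap_enc_list by (intro enc_list_cong F)
  qed
qed

lemma enc_objective_pair:
  assumes "objective_class obj = C"
  shows "enc_objective (pair_arena sp A v0 M) (pair_objective A L obj) = tobjective C sp (input_code obj)"
proof (cases obj)
  case (Parity \<kappa>)
  have C: "C = Parity_Games" using assms Parity by simp
  show ?thesis
    unfolding Parity C pair_objective.simps enc_objective.simps tobjective.simps card_pair_arena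
  proof (rule ttables_eq, rule table_input_code)
    fix c a s
    assume c: "c \<in> set L" and s: "s = (if a = (0::nat) then (\<lambda>c. cell_vertex c) else (\<lambda>c. cell_vertex' c))"
    show "enc_nat (\<kappa> (deviator c) (side a c)) =
        tnth (s (enc_cell c)) (tnth (cell_deviator (enc_cell c)) (in_objective (input_code (Parity \<kappa>))))"
      using in_L_bounds[OF c] unfolding s vertex_enc_cell cell_deviator_enc_cell input_code
      by (simp add: players verts)
  qed simp
next
  case (Quantitative_Reachability T)
  have C: "C = Quantitative_Reachability_Games" using assms Quantitative_Reachability by simp
  show ?thesis
    unfolding Quantitative_Reachability C pair_objective.simps enc_objective.simps tobjective.simps
      card_pair_arena
  proof (rule ttables_eq, rule table_input_code)
    fix c a s
    assume c: "c \<in> set L" and s: "s = (if a = (0::nat) then (\<lambda>c. cell_vertex c) else (\<lambda>c. cell_vertex' c))"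
    show "enc_bool (mode c \<noteq> 0 \<and> side a c \<in> T (deviator c)) =
        tif (cell_mode (enc_cell c)) (tnth (s (enc_cell c)) (tnth (cell_deviator (enc_cell c))
          (in_objective (input_code (Quantitative_Reachability T))))) Leaf"
      using in_L_bounds[OF c]
      unfolding s vertex_enc_cell cell_deviator_enc_cell cell_mode_enc_cell input_code
      by (simp add: players verts tif_def enc_bool_def)
  qed simp
qed (use assms in \<open>auto simp: input_code intro!: enc_rewards_pair\<close>)

text \<open>A reduction has to output the exact code of an instance, hence the equality of
  trees.\<close>

lemma enc_pair_game:
  assumes "objective_class obj = C"
  shows "treduct C sp (input_code obj) = enc_game (pair_game sp obj)"
proof -
  let ?V = "tcells (input_code obj)"
  have "enc_table (length L) (\<lambda>x. enc_table (length L) (\<lambda>y.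
      enc_bool ((x, y) \<in> edges (pair_arena sp A v0 M)))) =
      tmap (\<lambda>c. tmap (\<lambda>d. tcell_step sp (input_code obj) c d) ?V) ?V"
  proof (rule table_input_code)
    fix x assume x: "x < length L"
    show "enc_table (length L) (\<lambda>y. enc_bool ((x, y) \<in> edges (pair_arena sp A v0 M))) =
      enc_list (\<lambda>d. enc_bool (cell_step sp A v0 M (L ! x) d)) L"
      by (rule enc_table_nth) (use x in \<open>auto simp: pair_arena_simps\<close>)
  next
    fix c assume "c \<in> set L"
    then show "enc_list (\<lambda>d. enc_bool (cell_step sp A v0 M c d)) L =
        tmap (\<lambda>d. tcell_step sp (input_code obj) (enc_cell c) d) ?V"
      unfolding tcells_input_code tmap_enc_list
      by (intro enc_list_cong tcell_step_input_code[symmetric])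
  qed
  moreover have "enc_table 2 (\<lambda>i. enc_table (length L) (\<lambda>v. enc_bool (v \<in> part (pair_arena sp A v0 M) i))) =
      Node (tmap (\<lambda>c. enc_bool True) ?V) (Node (tmap (\<lambda>c. enc_bool False) ?V) Leaf)"
  proof -
    have "enc_table (length L) (\<lambda>v. enc_bool (v \<in> part (pair_arena sp A v0 M) 0)) = tmap (\<lambda>c. enc_bool True) ?V"
      by (rule table_input_code[where F = "\<lambda>c. enc_bool True"]) (simp_all add: pair_arena_simps)
    moreover have "enc_table (length L) (\<lambda>v. enc_bool (v \<in> part (pair_arena sp A v0 M) 1)) = tmap (\<lambda>c. enc_bool False) ?V"
      by (rule table_input_code[where F = "\<lambda>c. enc_bool False"]) (simp_all add: pair_arena_simps)
    ultimately show ?thesis by (simp only: enc_table_2)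
  qed
  ultimately show ?thesis
    by (simp add: treduct_def pair_game_def enc_game_def enc_arena_def Let_def card_pair_arena
        enc_objective_pair[OF assms])
qed

lemma pair_game_instance:
  assumes "objective_on A obj" "objective_class obj = C"
  shows "instance_of (privilege C) (pair_game sp obj)"
proof -
  have "objective_on (pair_arena sp A v0 M) (pair_objective A L obj)"
    using assms(1) by (cases obj) (auto simp: pair_arena_simps)
  moreover have "objective_class (pair_objective A L obj) = C"
    using assms(2) by (cases obj) auto
  moreover have "{0, 1} = {..<2 :: nat}" by auto
  ultimately show ?thesis
    using arena_pair_arena[of sp] L_nonempty
    by (auto simp: privilege_def game_in_class_def pair_game_def pair_arena_simps)
qed

lemma positive_pair_game:
  assumes "objective_on A obj"
  shows "positive (privilege C) (pair_game sp obj) \<longleftrightarrow>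
    (\<forall>\<sigma>\<in>Comp A v0 M. \<not> violated sp A (payoff obj) v0 \<sigma>)"
  using violated_iff_unprivileged[OF assms, of sp]
  by (auto simp: privilege_def pair_game_def not_less)

end

lemma mealy_instance_of_input:
  assumes "game_in_class C G" "mealy_input G M"
  shows "mealy_instance (arena_of G) (initial G) M (card (players (arena_of G)))
    (card (states M)) (card (verts (arena_of G)))"
  using assms unfolding game_in_class_def mealy_input_def by unfold_locales auto

text \<open>The history \<open>[v]\<close> forces \<open>v = v0\<close>, and the empty prefix
  changes neither payoff nor profile.\<close>

lemma nash_equilibrium_iff:
  "\<not> violated False A \<mu> v0 \<sigma> \<longleftrightarrow> nash_equilibrium A \<mu> v0 \<sigma>"
  by (auto simp: violated_def history_def)

text \<open>Membership in \<open>Comp\<close> supplies the conjunct \<open>profile\<close>, which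
  \<open>violated\<close> does not contain.\<close>

lemma subgame_perfect_equilibrium_iff:
  "\<sigma> \<in> Comp A v0 M \<Longrightarrow> \<not> violated True A \<mu> v0 \<sigma> \<longleftrightarrow> subgame_perfect_equilibrium A \<mu> v0 \<sigma>"
  by (auto simp: violated_def subgame_perfect_equilibrium_def Comp_def)

text \<open>Abstracts what the four problems share: the deterministic variants have fewer instances
  but the same positive ones among them, so the same tree function works.\<close>

lemma reduces_to_privilege:
  assumes inst: "\<And>G M. instance_of P (G, M) \<Longrightarrow> game_in_class C G \<and> mealy_input G M"
    and pos: "\<And>G M. positive P (G, M) \<longleftrightarrow> (\<forall>\<sigma>\<in>Comp (arena_of G) (initial G) M.
      \<not> violated sp (arena_of G) (payoff (objective_of G)) (initial G) \<sigma>)"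
    and enc: "encode P = enc_checking"
  shows "P \<le>\<^sub>p privilege C"
  unfolding reduces_poly_time_def
proof (rule exI[of _ "treduct C sp"], rule conjI, rule poly_time_treduct, intro allI impI)
  fix x assume x: "instance_of P x"
  obtain G M where GM: "x = (G, M)" by (cases x)
  have G: "game_in_class C G" "mealy_input G M" using inst x GM by auto
  interpret mealy_instance "arena_of G" "initial G" M "card (players (arena_of G))"
    "card (states M)" "card (verts (arena_of G))"
    by (rule mealy_instance_of_input[OF G])
  let ?y = "pair_game sp (objective_of G)"
  have obj: "objective_on (arena_of G) (objective_of G)" "objective_class (objective_of G) = C"
    using G(1) by (auto simp: game_in_class_def)
  have "\<lparr> arena_of = arena_of G, objective_of = objective_of G, initial = initial G \<rparr> = G" by simp
  then have "encode P x = input_code (objective_of G)" by (simp only: enc GM input_code_def)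
  moreover have "encode (privilege C) = enc_game" by (simp add: privilege_def)
  ultimately have "treduct C sp (encode P x) = encode (privilege C) ?y"
    using enc_pair_game[OF obj(2), of sp] by simp
  moreover have "positive P x \<longleftrightarrow> positive (privilege C) ?y"
    unfolding GM pos positive_pair_game[OF obj(1)] ..
  ultimately show "\<exists>y. instance_of (privilege C) y \<and> treduct C sp (encode P x) = encode (privilege C) y \<and>
      (positive P x \<longleftrightarrow> positive (privilege C) y)"
    using pair_game_instance[OF obj, of sp] by blast
qed

theorem corollary9:
  fixes C :: game_class
  shows "nash_checking C \<le>\<^sub>p privilege C \<and>
         deterministic_nash_checking C \<le>\<^sub>p privilege C \<and>
         subgame_perfect_checking C \<le>\<^sub>p privilege C \<and>
         deterministic_subgame_perfect_checking C \<le>\<^sub>p privilege C"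
proof (intro conjI)
  show "nash_checking C \<le>\<^sub>p privilege C"
    by (rule reduces_to_privilege[where sp = False])
      (auto simp: nash_checking_def nash_equilibrium_iff)
  show "deterministic_nash_checking C \<le>\<^sub>p privilege C"
    by (rule reduces_to_privilege[where sp = False])
      (auto simp: deterministic_nash_checking_def restrict_deterministic_def nash_checking_def
        nash_equilibrium_iff)
  show "subgame_perfect_checking C \<le>\<^sub>p privilege C"
    by (rule reduces_to_privilege[where sp = True])
      (auto simp: subgame_perfect_checking_def subgame_perfect_equilibrium_iff)
  show "deterministic_subgame_perfect_checking C \<le>\<^sub>p privilege C"
    by (rule reduces_to_privilege[where sp = True])
      (auto simp: deterministic_subgame_perfect_checking_def restrict_deterministic_def
        subgame_perfect_checking_def subgame_perfect_equilibrium_iff)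
qed

end
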